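(* Let $d\ge1$ and let $\mu$ be a symmetric nonnegative Radon measure on $\mathbb{R}^d\setminus\{0\}$ with $\int(|z|^2\wedge1)\,\mathrm{d}\mu(z)<+\infty$. Then the following statements are equivalent: (a) If $u\in L^\infty(\mathbb{R}^d)$ satisfies $\mathcal{L}^\mu[u]=0$ in $\mathcal{D}'(\mathbb{R}^d)$, then $u$ is constant (almost everywhere). (b) The additive subgroup of $\mathbb{R}^d$ generated by $\operatorname{supp}(\mu)$ is dense in $\mathbb{R}^d$. (c) For every vector subspace $V\subseteq\mathbb{R}^d$ of dimension less than or equal to $d-1$ and every relative lattice $\Lambda\subseteq\mathbb{R}^d$ such that $V\cap\operatorname{Span}_{\mathbb{R}}\Lambda=\{0\}$, one has $\operatorname{supp}(\mu)\not\subseteq V\oplus\Lambda$. (d) For every vector subspace $H\subseteq\mathbb{R}^d$ of dimension $d-1$ and every vector $c\in\mathbb{R}^d$, one has $\operatorname{supp}(\mu)\not\subseteq H+c\mathbb{Z}$.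
   Context: A nonnegative Radon measure on $\mathbb{R}^d\setminus\{0\}$ is a nonnegative Borel measure on $\mathbb{R}^d\setminus\{0\}$ finite on compact subsets of $\mathbb{R}^d\setminus\{0\}$. It is symmetric if $\mu(B)=\mu(-B)$ for all Borel $B$. Its support is $\operatorname{supp}(\mu)=\{z\in\mathbb{R}^d\setminus\{0\}:\mu(B_r(z))>0\ \forall r>0\}$, where $B_r(z)$ is the ball of center $z$ and radius $r$. The symbol $\wedge$ denotes the minimum. The operator $\mathcal{L}^\mu$ is $$\mathcal{L}^\mu[\psi](x)=\mathrm{P.V.}\int_{\mathbb{R}^d\setminus\{0\}}\big(\psi(x+z)-\psi(x)\big)\,\mathrm{d}\mu(z)=\lim_{r\to0^+}\int_{|z|>r}\big(\psi(x+z)-\psi(x)\big)\,\mathrm{d}\mu(z),$$ well defined for $C^2$ functions $\psi$ bounded together with their derivatives up to order two. For $u\in L^\infty(\mathbb{R}^d)$, "$\mathcal{L}^\mu[u]=0$ in $\mathcal{D}'(\mathbb{R}^d)$" means $\int_{\mathbb{R}^d}u(x)\,\mathcal{L}^\mu[\psi](x)\,\mathrm{d}x=0$ for all $\psi\in C_c^\infty(\mathbb{R}^d)$. A relative lattice of $\mathbb{R}^d$ is a subgroup of the form $\bigoplus_{n=1}^m a_n\mathbb{Z}$ with $a_1,\dots,a_m\in\mathbb{R}^d$ linearly independent over $\mathbb{R}$ and $0\le m\le d$ (by convention $\{0\}$ is a relative lattice). $V\oplus\Lambda$ denotes the sum $V+\Lambda$ of two subgroups with $V\cap\Lambda=\{0\}$.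 *)

theory Defs
  imports "HOL-Analysis.Analysis" "HOL-Computational_Algebra.Group_Closure"
begin

text \<open>
  A measure on \<open>\<real>\<^sup>d \ {0}\<close> has the punctured space itself as its carrier, so
  \<open>0\<close> belongs to no measurable set.
\<close>

definition nonneg_radon_punctured :: "'a::euclidean_space measure \<Rightarrow> bool" where
  "nonneg_radon_punctured \<mu> \<longleftrightarrow>
     sets \<mu> = sets (restrict_space borel (- {0})) \<and>
     (\<forall>K. compact K \<longrightarrow> K \<subseteq> - {0} \<longrightarrow> emeasure \<mu> K < \<infinity>)"

definition symmetric_measure :: "'a::euclidean_space measure \<Rightarrow> bool" where
  "symmetric_measure \<mu> \<longleftrightarrow> (\<forall>B\<in>sets \<mu>. emeasure \<mu> B = emeasure \<mu> (uminus ` B))"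

text \<open>
  The ball is intersected with the carrier: \<open>emeasure\<close> is \<open>0\<close> on
  non-measurable sets, and a ball containing \<open>0\<close> is not in \<open>sets \<mu>\<close>.
\<close>

definition supp :: "'a::euclidean_space measure \<Rightarrow> 'a set" where
  "supp \<mu> = {z. z \<noteq> 0 \<and> (\<forall>r>0. emeasure \<mu> (ball z r - {0}) > 0)}"

definition levy_op :: "'a::euclidean_space measure \<Rightarrow> ('a \<Rightarrow> real) \<Rightarrow> 'a \<Rightarrow> real" where
  "levy_op \<mu> \<psi> x =
     Lim (at_right 0) (\<lambda>r. LINT z:{z. norm z > r}|\<mu>. \<psi> (x + z) - \<psi> x)"

text \<open>\<open>C\<^sup>k\<close> regularity on the whole space, by recursion on directional derivatives.\<close>

fun C_diff :: "nat \<Rightarrow> ('a::euclidean_space \<Rightarrow> real) \<Rightarrow> bool" where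
  "C_diff 0 f \<longleftrightarrow> continuous_on UNIV f"
| "C_diff (Suc k) f \<longleftrightarrow>
     (\<forall>x. f differentiable (at x)) \<and>
     (\<forall>v. C_diff k (\<lambda>x. frechet_derivative f (at x) v))"

definition test_function :: "('a::euclidean_space \<Rightarrow> real) \<Rightarrow> bool" where
  "test_function \<psi> \<longleftrightarrow> (\<forall>k. C_diff k \<psi>) \<and> compact (closure {x. \<psi> x \<noteq> 0})"

text \<open>
  Elements of \<open>L\<^sup>\<infinity>\<close> are represented by Lebesgue measurable functions, which agree
  almost everywhere with Borel ones.
\<close>

definition L_infinity :: "('a::euclidean_space \<Rightarrow> real) \<Rightarrow> bool" where
  "L_infinity u \<longleftrightarrow>
     u \<in> borel_measurable lebesgue \<and> (\<exists>C. AE x in lebesgue. \<bar>u x\<bar> \<le> C)"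

definition levy_harmonic :: "'a::euclidean_space measure \<Rightarrow> ('a \<Rightarrow> real) \<Rightarrow> bool" where
  "levy_harmonic \<mu> u \<longleftrightarrow>
     (\<forall>\<psi>. test_function \<psi> \<longrightarrow> (LINT x|lebesgue. u x * levy_op \<mu> \<psi> x) = 0)"

definition liouville_property :: "'a::euclidean_space measure \<Rightarrow> bool" where
  "liouville_property \<mu> \<longleftrightarrow>
     (\<forall>u. L_infinity u \<longrightarrow> levy_harmonic \<mu> u \<longrightarrow> (\<exists>c. AE x in lebesgue. u x = c))"

definition relative_lattice :: "'a::euclidean_space set \<Rightarrow> bool" where
  "relative_lattice \<Lambda> \<longleftrightarrow>
     (\<exists>A. finite A \<and> independent A \<and>
          \<Lambda> = {(\<Sum>a\<in>A. real_of_int (k a) *\<^sub>R a) | k. True})"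

end

theory Submission
  imports Defs "HOL-Computational_Algebra.Polynomial"
begin

text \<open>
  Let \<open>G\<close> be the subgroup generated by \<open>supp \<mu>\<close>. By symmetry of \<open>\<mu>\<close>, the operator is half the
  integral of the second differences \<open>\<psi> (x + z) + \<psi> (x - z) - 2 \<psi> x\<close>, which are
  \<open>O(|z|\<^sup>2 \<and> 1)\<close> both uniformly and in \<open>L\<^sup>1\<close>; hence Fubini's theorem moves them onto \<open>u\<close>.

  If \<open>G\<close> is not dense, then \<open>x \<mapsto> 1 \<and> dist(x, G)\<close> is \<open>G\<close>-periodic, hence a nonconstant solution.
  If \<open>G\<close> is dense, pairing \<open>u\<close> with the translates of a test function gives a Lipschitz solution
  \<open>U\<close>. For \<open>z \<in> supp \<mu>\<close>, a sequence along which \<open>V = U(\<cdot> + z) - U\<close> approaches its supremum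
  \<open>S\<close> still does so after translation by \<open>z\<close>, so \<open>U(\<cdot> + k z) - U\<close> gets close to \<open>k S\<close> for
  every \<open>k\<close>, and boundedness of \<open>U\<close> forces \<open>S \<le> 0\<close>. Thus \<open>U\<close> is \<open>G\<close>-periodic, so constant,
  and a bounded \<open>u\<close> all of whose pairings are translation invariant is constant almost everywhere.

  For the group-theoretic conditions, a proper closed subgroup of \<open>\<real>\<^sup>d\<close> has a nonzero vector \<open>\<xi>\<close>
  with integral inner products on it: it is the sum of a subspace and a discrete subgroup of the
  orthogonal complement, and some multiple of a dual basis functional works.
\<close>

section \<open>Closed subgroups of Euclidean space\<close>

definition add_subgroup :: "'a::ab_group_add set \<Rightarrow> bool" where
  "add_subgroup G \<longleftrightarrow> 0 \<in> G \<and> (\<forall>x\<in>G. \<forall>y\<in>G. x - y \<in> G)"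

lemma add_subgroup_closed:
  assumes "add_subgroup G"
  shows "0 \<in> G" and "x \<in> G \<Longrightarrow> y \<in> G \<Longrightarrow> x - y \<in> G" and "x \<in> G \<Longrightarrow> - x \<in> G"
    and "x \<in> G \<Longrightarrow> y \<in> G \<Longrightarrow> x + y \<in> G"
proof -
  show zero: "0 \<in> G"
    using assms by (simp add: add_subgroup_def)
  show diff: "x - y \<in> G" if "x \<in> G" "y \<in> G"
    using assms that by (simp add: add_subgroup_def)
  show neg: "- x \<in> G" if "x \<in> G"
    using assms that zero unfolding add_subgroup_def by (metis diff_0)
  show "x + y \<in> G" if "x \<in> G" "y \<in> G"
    using assms that zero unfolding add_subgroup_def by (metis diff_0 diff_minus_eq_add)
qed

lemma add_subgroup_scaleR_int:
  fixes G :: "'a::real_vector set"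
  assumes "add_subgroup G" and "x \<in> G"
  shows "real_of_int k *\<^sub>R x \<in> G"
proof (induction k rule: int_induct[where k = 0])
  case base
  show ?case
    using add_subgroup_closed(1)[OF assms(1)] by simp
next
  case (step1 i)
  then show ?case
    using add_subgroup_closed(4)[OF assms(1) step1(2) assms(2)] by (simp add: algebra_simps)
next
  case (step2 i)
  then show ?case
    using add_subgroup_closed(2)[OF assms(1) step2(2) assms(2)] by (simp add: algebra_simps)
qed

lemma add_subgroup_sum:
  assumes "add_subgroup G" and "\<And>i. i \<in> I \<Longrightarrow> f i \<in> G"
  shows "sum f I \<in> G"
  using assms(2) add_subgroup_closed(1,4)[OF assms(1)]
  by (induction I rule: infinite_finite_induct) auto

lemma add_subgroup_group_closure: "add_subgroup (group_closure S)"
  by (auto simp: add_subgroup_def intro: group_closure.diff)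

lemma group_closure_least:
  assumes "add_subgroup G" and "S \<subseteq> G"
  shows "group_closure S \<subseteq> G"
proof
  fix x assume "x \<in> group_closure S"
  then show "x \<in> G"
    by induction (use assms add_subgroup_closed[OF assms(1)] in auto)
qed

lemma add_subgroup_closure:
  fixes G :: "'a::real_normed_vector set"
  assumes "add_subgroup G"
  shows "add_subgroup (closure G)"
proof -
  have "x - y \<in> closure G" if "x \<in> closure G" "y \<in> closure G" for x y
  proof -
    obtain a where a: "\<And>n. a n \<in> G" "a \<longlonglongrightarrow> x"
      using \<open>x \<in> closure G\<close> by (auto simp: closure_sequential)
    obtain b where b: "\<And>n. b n \<in> G" "b \<longlonglongrightarrow> y"
      using \<open>y \<in> closure G\<close> by (auto simp: closure_sequential)
    have "(\<lambda>n. a n - b n) \<longlonglongrightarrow> x - y"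
      by (intro tendsto_intros a b)
    moreover have "a n - b n \<in> G" for n
      using a b add_subgroup_closed(2)[OF assms] by blast
    ultimately show ?thesis
      unfolding closure_sequential by (intro exI conjI allI)
  qed
  then show ?thesis
    using add_subgroup_closed(1)[OF assms] closure_subset by (auto simp: add_subgroup_def)
qed

text \<open>
  The integer multiples \<open>\<lfloor>t / |x|\<rfloor> x\<close> of short vectors \<open>x\<close> of \<open>D\<close> approximate the points \<open>t v\<close> of
  the line through a limit \<open>v\<close> of the directions of \<open>x\<close>.
\<close>

lemma closed_subgroup_without_lines_discrete:
  fixes D :: "'a::euclidean_space set"
  assumes D: "add_subgroup D" and "closed D"
    and no_line: "\<And>v. (\<And>t. t *\<^sub>R v \<in> D) \<Longrightarrow> v = 0"
  obtains \<delta> where "\<delta> > 0" "\<And>x. x \<in> D \<Longrightarrow> norm x < \<delta> \<Longrightarrow> x = 0"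
proof (rule ccontr)
  assume "\<not> thesis"
  then have "\<exists>x\<in>D. norm x < inverse (real (Suc n)) \<and> x \<noteq> 0" for n
    using that[of "inverse (real (Suc n))"] by force
  then obtain x where x: "\<And>n. x n \<in> D" "\<And>n. norm (x n) < inverse (real (Suc n))" "\<And>n. x n \<noteq> 0"
    by metis
  define u where "u n = x n /\<^sub>R norm (x n)" for n
  have "\<forall>n. u n \<in> sphere 0 1"
    using x(3) by (simp add: u_def)
  then obtain v r where v: "v \<in> sphere 0 1" and r: "strict_mono r" and lim: "(u \<circ> r) \<longlonglongrightarrow> v"
    using compact_sphere[of "0::'a" 1] unfolding compact_def by metis
  have norm_lim: "(\<lambda>n. norm (x n)) \<longlonglongrightarrow> 0"
    by (rule tendsto_sandwich[OF _ _ tendsto_const LIMSEQ_inverse_real_of_nat])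
      (use x(2) in \<open>auto intro!: always_eventually less_imp_le\<close>)
  have "t *\<^sub>R v \<in> D" for t
  proof -
    define k where "k n = \<lfloor>t / norm (x n)\<rfloor>" for n
    have "\<bar>real_of_int (k n) * norm (x n) - t\<bar> \<le> norm (x n)" for n
    proof -
      have "norm (x n) > 0"
        using x(3) by simp
      moreover have "\<bar>real_of_int (k n) - t / norm (x n)\<bar> \<le> 1"
        unfolding k_def by linarith
      ultimately have "\<bar>real_of_int (k n) - t / norm (x n)\<bar> * norm (x n) \<le> norm (x n)"
        by simp
      then show ?thesis
        using \<open>norm (x n) > 0\<close> by (simp add: abs_mult_pos left_diff_distrib)
    qed
    then have "(\<lambda>n. real_of_int (k n) * norm (x n) - t) \<longlonglongrightarrow> 0"
      by (intro Lim_null_comparison[OF _ norm_lim] always_eventually) simp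
    then have "(\<lambda>n. real_of_int (k n) * norm (x n)) \<longlonglongrightarrow> t"
      using LIM_zero_iff by blast
    then have line: "(\<lambda>n. (real_of_int (k (r n)) * norm (x (r n))) *\<^sub>R u (r n)) \<longlonglongrightarrow> t *\<^sub>R v"
      using LIMSEQ_subseq_LIMSEQ[OF _ r] lim by (intro tendsto_scaleR) (auto simp: o_def)
    have "(real_of_int (k (r n)) * norm (x (r n))) *\<^sub>R u (r n) \<in> D" for n
      using add_subgroup_scaleR_int[OF D x(1)] x(3) by (simp add: u_def mult.assoc)
    then show ?thesis
      by (rule closed_sequentially[OF \<open>closed D\<close> _ line])
  qed
  then have "v = 0"
    by (rule no_line)
  with v show False
    by simp
qed

text \<open>Bolzano-Weierstrass: infinitely many bounded points would accumulate somewhere, and two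
  distinct points of \<open>D\<close> near the limit point differ by a nonzero vector shorter than
  \<open>\<delta>\<close>.\<close>

lemma discrete_subgroup_bounded_finite:
  fixes D :: "'a::euclidean_space set"
  assumes D: "add_subgroup D" and "\<delta> > 0" and discrete: "\<And>x. x \<in> D \<Longrightarrow> norm x < \<delta> \<Longrightarrow> x = 0"
    and "bounded S"
  shows "finite (D \<inter> S)"
proof (rule ccontr)
  assume "infinite (D \<inter> S)"
  moreover have "bounded (D \<inter> S)"
    using \<open>bounded S\<close> by (rule bounded_subset) simp
  ultimately obtain l where l: "l islimpt (D \<inter> S)"
    using bounded_infinite_imp_islimpt by blast
  then obtain x where x: "x \<in> D" "x \<noteq> l" "dist x l < \<delta> / 2"
    unfolding islimpt_approachable using \<open>\<delta> > 0\<close> by (meson IntD1 half_gt_zero)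
  then obtain y where y: "y \<in> D" "y \<noteq> l" "dist y l < dist x l"
    using l unfolding islimpt_approachable by (meson IntD1 zero_less_dist_iff)
  have "norm (x - y) < \<delta>"
    using x(3) y(3) dist_triangle2[of x y l] by (simp add: dist_norm)
  then have "x = y"
    using discrete[OF add_subgroup_closed(2)[OF D x(1) y(1)]] by simp
  with y show False
    by simp
qed

text \<open>
  For a maximal independent set \<open>B\<close> in \<open>D\<close>, the multiples of \<open>x\<close> reduced modulo the lattice
  spanned by \<open>B\<close> lie in the finite set \<open>D \<inter> S\<close>, so two of the first \<open>card (D \<inter> S) + 1\<close> coincide.
\<close>

lemma discrete_subgroup_dual_vector:
  fixes D :: "'a::euclidean_space set"
  assumes D: "add_subgroup D" and "\<delta> > 0" and discrete: "\<And>x. x \<in> D \<Longrightarrow> norm x < \<delta> \<Longrightarrow> x = 0"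
    and "b \<in> D" "b \<noteq> 0"
  obtains f where "linear f" "f b \<noteq> 0" "\<And>x. x \<in> D \<Longrightarrow> f x \<in> (\<int> :: real set)"
proof -
  \<comment> \<open>The basis is built around \<open>b\<close>, so that the coordinate along
    \<open>b\<close> is a functional not vanishing at \<open>b\<close>.\<close>
  obtain B where B: "{b} \<subseteq> B" "B \<subseteq> D" "independent B" "D \<subseteq> span B"
    using maximal_independent_subset_extend[of "{b}" D] \<open>b \<in> D\<close> \<open>b \<noteq> 0\<close> by auto
  have "finite B"
    using B(3) by (rule independent_bound[THEN conjunct1])
  define S where "S = (\<lambda>t. \<Sum>a\<in>B. t a *\<^sub>R a) ` (B \<rightarrow>\<^sub>E {0..1::real})"
  have "bounded S"
  proof -
    have "norm (\<Sum>a\<in>B. t a *\<^sub>R a) \<le> (\<Sum>a\<in>B. norm a)" if "t \<in> B \<rightarrow>\<^sub>E {0..1}" for t :: "'a \<Rightarrow> real"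
    proof (rule order_trans[OF norm_sum sum_mono])
      fix a assume "a \<in> B"
      then have "0 \<le> t a" "t a \<le> 1"
        using that by (auto simp: PiE_iff)
      then show "norm (t a *\<^sub>R a) \<le> norm a"
        by (simp add: mult_left_le_one_le)
    qed
    then show ?thesis
      unfolding S_def bounded_iff by blast
  qed
  then have fin: "finite (D \<inter> S)"
    using discrete_subgroup_bounded_finite[OF D \<open>\<delta> > 0\<close>] discrete by blast
  define c where "c x a = representation B x a" for x a
  have c: "x = (\<Sum>a\<in>B. c x a *\<^sub>R a)" if "x \<in> span B" for x
    using sum_representation_eq[OF B(3) that \<open>finite B\<close> subset_refl] by (simp add: c_def)
  define K where "K = card (D \<inter> S)"
  have multiple: "\<exists>k\<in>{1..K}. \<forall>a\<in>B. real k * c x a \<in> \<int>" if "x \<in> D" for x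
  proof -
    have x: "x \<in> span B"
      using B(4) that by blast
    define y where "y j = (\<Sum>a\<in>B. frac (real j * c x a) *\<^sub>R a)" for j :: nat
    have y: "y j = real j *\<^sub>R x - (\<Sum>a\<in>B. real_of_int \<lfloor>real j * c x a\<rfloor> *\<^sub>R a)" for j
      using arg_cong[OF c[OF x], of "(*\<^sub>R) (real j)"]
      by (simp add: y_def frac_def scaleR_diff_left sum_subtractf scaleR_sum_right)
    have "y j \<in> D" for j
      unfolding y using add_subgroup_scaleR_int[OF D that, of "int j"] B(2)
      by (intro add_subgroup_closed(2)[OF D] add_subgroup_sum[OF D] add_subgroup_scaleR_int[OF D]) auto
    moreover have "y j \<in> S" for j
    proof -
      have "y j = (\<Sum>a\<in>B. restrict (\<lambda>a. frac (real j * c x a)) B a *\<^sub>R a)"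
        by (simp add: y_def)
      moreover have "restrict (\<lambda>a. frac (real j * c x a)) B \<in> B \<rightarrow>\<^sub>E {0..1}"
        by (auto simp: frac_ge_0 frac_lt_1 less_imp_le)
      ultimately show ?thesis
        unfolding S_def by blast
    qed
    ultimately have "y ` {0..K} \<subseteq> D \<inter> S"
      by auto
    then have "card (y ` {0..K}) \<le> K"
      unfolding K_def by (rule card_mono[OF fin])
    then have "\<not> inj_on y {0..K}"
      by (intro pigeonhole) simp
    then obtain i j where ij: "i < j" "j \<le> K" "y i = y j"
      unfolding inj_on_def by (metis atLeastAtMost_iff linorder_neqE_nat)
    have "real (j - i) * c x a \<in> \<int>" if "a \<in> B" for a
    proof -
      have "c (y n) a = frac (real n * c x a)" for n
      proof -
        have "representation B (y n) a = (\<Sum>a'\<in>B. frac (real n * c x a') * representation B a' a)"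
          unfolding y_def
          by (subst representation_sum[OF B(3)])
            (auto simp: representation_scale[OF B(3)] span_base span_scale)
        also have "\<dots> = (\<Sum>a'\<in>B. if a' = a then frac (real n * c x a) else 0)"
          using B(3) by (intro sum.cong) (auto simp: representation_basis)
        finally show ?thesis
          using \<open>finite B\<close> that by (simp add: c_def)
      qed
      with ij have "frac (real j * c x a) = frac (real i * c x a)"
        by metis
      then have "real j * c x a - real i * c x a = of_int (\<lfloor>real j * c x a\<rfloor> - \<lfloor>real i * c x a\<rfloor>)"
        by (simp add: frac_def)
      then show ?thesis
        using ij(1) by (metis Ints_of_int left_diff_distrib of_nat_diff less_imp_le)
    qed
    then show ?thesis
      using ij by (intro bexI[of _ "j - i"]) auto
  qed
  \<comment> \<open>\<open>g\<close> is the coordinate along \<open>b\<close> scaled by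
    \<open>fact K\<close>: every multiplier \<open>k\<close> found above is at most
    \<open>K\<close>, hence divides \<open>fact K\<close>, which makes \<open>g\<close> integral on
    \<open>D\<close>.\<close>
  obtain g where g: "linear g" "\<And>a. a \<in> B \<Longrightarrow> g a = (if a = b then real (fact K) else 0)"
    using linear_independent_extend[OF B(3), of "\<lambda>a. if a = b then real (fact K) else 0"] by blast
  show thesis
  proof (rule that[of g])
    show "g b \<noteq> 0"
      using g(2)[of b] B(1) by simp
    fix x assume "x \<in> D"
    then obtain k where k: "k \<in> {1..K}" "real k * c x b \<in> \<int>"
      using multiple B(1) by blast
    have "g x = (\<Sum>a\<in>B. c x a *\<^sub>R g a)"
    proof -
      have "g x = g (\<Sum>a\<in>B. c x a *\<^sub>R a)"
        by (rule arg_cong[OF c]) (use B(4) \<open>x \<in> D\<close> in blast)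
      then show ?thesis
        by (simp add: linear_sum[OF g(1)] linear_scale[OF g(1)])
    qed
    also have "\<dots> = (\<Sum>a\<in>B. if a = b then c x b * real (fact K) else 0)"
      using g(2) by (intro sum.cong) auto
    also have "\<dots> = real (fact K) * c x b"
      using \<open>finite B\<close> B(1) by simp
    also obtain q where "fact K = k * q"
      using k(1) dvd_fact[of k K] by (auto elim: dvdE)
    then have "real (fact K) * c x b = real q * (real k * c x b)"
      by simp
    finally show "g x \<in> \<int>"
      using k(2) by simp
  qed (rule g)
qed

text \<open>Split off the largest subspace \<open>V\<close> of \<open>G\<close>. The rest
  \<open>D\<close>, the part of \<open>G\<close> orthogonal to \<open>V\<close>, contains no line
  and so is discrete. A vector orthogonal to \<open>V\<close> sees only the component in
  \<open>D\<close> of a point of \<open>G\<close>, so it is enough to find one that is integral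
  there.\<close>

lemma nondense_subgroup_dual_vector:
  fixes G :: "'a::euclidean_space set"
  assumes G: "add_subgroup G" "closed G" "G \<noteq> UNIV"
  obtains \<xi> where "\<xi> \<noteq> 0" "\<And>x. x \<in> G \<Longrightarrow> \<xi> \<bullet> x \<in> \<int>"
proof -
  define V where "V = {x. \<forall>t. t *\<^sub>R x \<in> G}"
  have V: "subspace V"
    unfolding subspace_def V_def
    using add_subgroup_closed[OF G(1)] by (auto simp: scaleR_add_right)
  have VG: "V \<subseteq> G"
    unfolding V_def by (auto dest: spec[of _ 1])
  define W where "W = {y. \<forall>x\<in>V. orthogonal x y}"
  have decomp: "\<exists>v\<in>V. \<exists>w\<in>W. x = v + w" for x
  proof -
    obtain v w where "v \<in> span V" "\<And>y. y \<in> span V \<Longrightarrow> orthogonal w y" "x = v + w"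
      using orthogonal_subspace_decomp_exists[of V x] by metis
    moreover have "span V = V"
      using V by (simp add: span_eq_iff)
    ultimately have "v \<in> V" "w \<in> W" "x = v + w"
      unfolding W_def using orthogonal_commute by blast+
    then show ?thesis
      by blast
  qed
  define D where "D = G \<inter> W"
  have W: "subspace W"
    unfolding W_def by (rule subspace_orthogonal_to_vectors)
  have D: "add_subgroup D"
    using add_subgroup_closed[OF G(1)] subspace_diff[OF W] subspace_0[OF W]
    by (auto simp: D_def add_subgroup_def)
  have "closed D"
    unfolding D_def by (intro closed_Int G(2) closed_subspace W)
  have no_line: "v = 0" if "\<And>t. t *\<^sub>R v \<in> D" for v
  proof -
    have "v \<in> V" "v \<in> W"
      using that that[of 1] by (auto simp: V_def D_def)
    then show ?thesis
      by (auto simp: W_def orthogonal_def)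
  qed
  obtain \<delta> where \<delta>: "\<delta> > 0" "\<And>x. x \<in> D \<Longrightarrow> norm x < \<delta> \<Longrightarrow> x = 0"
    using closed_subgroup_without_lines_discrete[OF D \<open>closed D\<close> no_line] by metis
  show thesis
  proof (cases "D \<subseteq> {0}")
    \<comment> \<open>Here \<open>G\<close> equals \<open>V\<close>, and the normal component of a
      point outside \<open>G\<close> is a nonzero vector orthogonal to all of
      \<open>G\<close>.\<close>
    case True
    obtain x where "x \<notin> G"
      using G(3) by blast
    obtain v w where vw: "v \<in> V" "w \<in> W" "x = v + w"
      using decomp by blast
    show thesis
    proof (rule that[of w])
      show "w \<noteq> 0"
        using vw VG \<open>x \<notin> G\<close> by auto
      fix y assume "y \<in> G"
      obtain v' w' where vw': "v' \<in> V" "w' \<in> W" "y = v' + w'"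
        using decomp by blast
      then have "w' \<in> D"
        using \<open>y \<in> G\<close> VG add_subgroup_closed(2)[OF G(1), of y v'] by (auto simp: D_def)
      then have "y \<in> V"
        using True vw' by auto
      then show "w \<bullet> y \<in> \<int>"
        using vw(2) by (simp add: W_def orthogonal_def inner_commute[of w])
    qed
  next
    case False
    then obtain b where b: "b \<in> D" "b \<noteq> 0"
      by blast
    obtain f where f: "linear f" "f b \<noteq> 0" "\<And>x. x \<in> D \<Longrightarrow> f x \<in> (\<int> :: real set)"
      using discrete_subgroup_dual_vector[OF D \<delta> b] by metis
    \<comment> \<open>The functional is represented by a vector, of which only the component
      \<open>w\<close> orthogonal to \<open>V\<close> is kept: it still induces \<open>f\<close> on
      \<open>W\<close>, and it annihilates \<open>V\<close>.\<close>
    define \<eta> where "\<eta> = adjoint f 1"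
    have \<eta>: "\<eta> \<bullet> x = f x" for x
      using adjoint_works[OF f(1), of x 1] by (simp add: \<eta>_def inner_commute)
    obtain v w where vw: "v \<in> V" "w \<in> W" "\<eta> = v + w"
      using decomp by blast
    have w: "w \<bullet> x = f x" if "x \<in> W" for x
      using \<eta>[of x] vw(1,3) that by (simp add: W_def orthogonal_def inner_add_left)
    show thesis
    proof (rule that[of w])
      show "w \<noteq> 0"
        using w[of b] b f(2) by (auto simp: D_def)
      fix y assume "y \<in> G"
      obtain v' w' where vw': "v' \<in> V" "w' \<in> W" "y = v' + w'"
        using decomp by blast
      then have "w' \<in> D"
        using \<open>y \<in> G\<close> VG add_subgroup_closed(2)[OF G(1), of y v'] by (auto simp: D_def)
      moreover have "w \<bullet> y = w \<bullet> w'"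
        using vw(2) vw'(1,3) by (simp add: W_def orthogonal_def inner_commute[of w v'] inner_add_right)
      ultimately show "w \<bullet> y \<in> \<int>"
        using w[OF vw'(2)] f(3) by simp
    qed
  qed
qed

section \<open>Density of the generated group in terms of hyperplanes and lattices\<close>

text \<open>Both conditions fail exactly when some nonzero vector has integral inner products with
  all of \<open>S\<close>: the points with this property form equally spaced parallel hyperplanes,
  that is, a hyperplane plus the integer multiples of one vector.\<close>

lemma dense_group_closure_iff_hyperplanes:
  fixes S :: "'a::euclidean_space set"
  shows "closure (group_closure S) = UNIV \<longleftrightarrow>
    (\<forall>H c. subspace H \<longrightarrow> dim H = DIM('a) - 1 \<longrightarrow>
      \<not> S \<subseteq> H + range (\<lambda>k::int. real_of_int k *\<^sub>R c))" (is "?dense \<longleftrightarrow> ?hyp")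
proof
  assume dense: ?dense
  show ?hyp
  proof (intro allI impI notI)
    fix H :: "'a set" and c
    assume H: "subspace H" "dim H = DIM('a) - 1" and S: "S \<subseteq> H + range (\<lambda>k::int. real_of_int k *\<^sub>R c)"
    obtain a where a: "a \<noteq> 0" "H \<subseteq> {x. a \<bullet> x = 0}"
      using lowdim_subset_hyperplane[of H] H span_superset by (metis DIM_positive diff_less order_trans zero_less_one)
    \<comment> \<open>Normalising by \<open>s\<close> gives \<open>c\<close> the value 1; if
      \<open>a\<close> is orthogonal to \<open>c\<close>, all values on \<open>S\<close> are 0 and
      any nonzero \<open>s\<close> serves.\<close>
    define s where "s = (if a \<bullet> c = 0 then 1 else a \<bullet> c)"
    have "s \<noteq> 0"
      by (simp add: s_def)
    define G where "G = {x. (a \<bullet> x) / s \<in> \<int>}"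
    have "add_subgroup G"
      by (auto simp: add_subgroup_def G_def inner_diff_right diff_divide_distrib)
    moreover have "S \<subseteq> G"
    proof
      fix x assume "x \<in> S"
      then obtain h k where "h \<in> H" "x = h + real_of_int k *\<^sub>R c"
        using S unfolding set_plus_def by blast
      then show "x \<in> G"
        using a(2) by (auto simp: G_def s_def inner_add_right)
    qed
    ultimately have "group_closure S \<subseteq> G"
      by (rule group_closure_least)
    moreover have "closed G"
    proof -
      have "closed ((\<lambda>x. (a \<bullet> x) / s) -` \<int>)"
        by (rule closed_vimage[OF closed_Ints]) (use \<open>s \<noteq> 0\<close> in \<open>auto intro!: continuous_intros\<close>)
      then show ?thesis
        by (simp add: G_def vimage_def)
    qed
    ultimately have "G = UNIV"
      using dense closure_minimal by blast
    \<comment> \<open>This point is chosen to have value 1/2, so it cannot lie in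
      \<open>G\<close>.\<close>
    then have "(a \<bullet> ((s / (2 * (a \<bullet> a))) *\<^sub>R a)) / s \<in> \<int>"
      unfolding G_def by blast
    then have "(1 / 2 :: real) \<in> \<int>"
      using a(1) \<open>s \<noteq> 0\<close> by (simp add: field_simps)
    then show False
      by (auto elim!: Ints_cases simp: field_simps)
  qed
next
  assume hyp: ?hyp
  show ?dense
  proof (rule ccontr)
    assume "\<not> ?dense"
    then obtain \<xi> where \<xi>: "\<xi> \<noteq> 0" "\<And>x. x \<in> closure (group_closure S) \<Longrightarrow> \<xi> \<bullet> x \<in> \<int>"
      using nondense_subgroup_dual_vector[OF add_subgroup_closure[OF add_subgroup_group_closure] closed_closure] by metis
    \<comment> \<open>The multiple of \<open>\<xi>\<close> with inner product 1 against
      \<open>\<xi>\<close>, so that subtracting \<open>\<xi> \<bullet> x\<close> times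
      \<open>c\<close> from \<open>x\<close> lands in the hyperplane.\<close>
    define c where "c = \<xi> /\<^sub>R (\<xi> \<bullet> \<xi>)"
    have "S \<subseteq> {x. \<xi> \<bullet> x = 0} + range (\<lambda>k::int. real_of_int k *\<^sub>R c)"
    proof
      fix x assume "x \<in> S"
      then have "x \<in> closure (group_closure S)"
        using closure_subset[of "group_closure S"] by (auto intro: group_closure.base)
      then obtain k :: int where k: "\<xi> \<bullet> x = real_of_int k"
        using \<xi>(2) by (auto elim: Ints_cases)
      have "\<xi> \<bullet> c = 1"
        using \<xi>(1) by (simp add: c_def)
      then have "x - real_of_int k *\<^sub>R c \<in> {x. \<xi> \<bullet> x = 0}"
        by (simp add: inner_diff_right k)
      moreover have "x = (x - real_of_int k *\<^sub>R c) + real_of_int k *\<^sub>R c"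
        by simp
      ultimately show "x \<in> {x. \<xi> \<bullet> x = 0} + range (\<lambda>k::int. real_of_int k *\<^sub>R c)"
        unfolding set_plus_def by blast
    qed
    with hyp show False
      using \<xi>(1) by (metis dim_hyperplane subspace_hyperplane)
  qed
qed

text \<open>The multiples of \<open>c\<close> either are absorbed by \<open>H\<close> or form a
  lattice of rank one transversal to it. Conversely, in \<open>V + \<Lambda>\<close> all but one
  generator of the lattice can be replaced by the full line it spans, which leaves a proper subspace
  plus the multiples of one vector.\<close>

lemma lattice_avoiding_iff_hyperplanes:
  fixes S :: "'a::euclidean_space set"
  shows "(\<forall>V \<Lambda>. subspace V \<longrightarrow> dim V \<le> DIM('a) - 1 \<longrightarrow> relative_lattice \<Lambda> \<longrightarrow>
      V \<inter> span \<Lambda> = {0} \<longrightarrow> \<not> S \<subseteq> V + \<Lambda>) \<longleftrightarrow>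
    (\<forall>H c. subspace H \<longrightarrow> dim H = DIM('a) - 1 \<longrightarrow>
      \<not> S \<subseteq> H + range (\<lambda>k::int. real_of_int k *\<^sub>R c))" (is "?lat \<longleftrightarrow> ?hyp")
proof
  assume lat: ?lat
  show ?hyp
  proof (intro allI impI notI)
    fix H :: "'a set" and c
    assume H: "subspace H" "dim H = DIM('a) - 1" and S: "S \<subseteq> H + range (\<lambda>k::int. real_of_int k *\<^sub>R c)"
    show False
    proof (cases "c \<in> H")
      case True
      have "relative_lattice {0::'a}"
        unfolding relative_lattice_def by (intro exI[of _ "{}"]) (auto simp: independent_empty)
      moreover have "H \<inter> span {0} = {0}"
        using subspace_0[OF H(1)] by auto
      moreover have "S \<subseteq> H + {0}"
        using S True H(1) by (force simp: set_plus_def intro: subspace_add subspace_scale)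
      ultimately show False
        using lat H by (metis order_refl)
    next
      case False
      then have "c \<noteq> 0"
        using subspace_0[OF H(1)] by auto
      let ?\<Lambda> = "range (\<lambda>k::int. real_of_int k *\<^sub>R c)"
      have "relative_lattice ?\<Lambda>"
        unfolding relative_lattice_def
      proof (intro exI[of _ "{c}"] conjI)
        have "\<exists>f :: 'a \<Rightarrow> int. real_of_int k *\<^sub>R c = real_of_int (f c) *\<^sub>R c" for k
          by (rule exI[of _ "\<lambda>_. k"]) simp
        then show "?\<Lambda> = {(\<Sum>a\<in>{c}. real_of_int (k a) *\<^sub>R a) | k. True}"
          by auto
      qed (use \<open>c \<noteq> 0\<close> in auto)
      moreover have "H \<inter> span ?\<Lambda> = {0}"
      proof -
        have "span ?\<Lambda> \<subseteq> span {c}"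
          by (intro span_minimal) (auto intro: span_scale span_base)
        moreover have "x = 0" if x: "x \<in> H" "x \<in> span {c}" for x
        proof -
          obtain t where "x = t *\<^sub>R c"
            using x(2) by (auto simp: span_singleton)
          then show ?thesis
            using subspace_scale[OF H(1) x(1), of "inverse t"] False by (cases "t = 0") auto
        qed
        ultimately show ?thesis
          using subspace_0[OF H(1)] span_0 by blast
      qed
      ultimately show False
        using lat H S by (metis order_refl)
    qed
  qed
next
  assume hyp: ?hyp
  have no_low: "\<not> S \<subseteq> W + range (\<lambda>k::int. real_of_int k *\<^sub>R c)" if W: "dim W < DIM('a)" for W and c :: 'a
  proof
    assume S: "S \<subseteq> W + range (\<lambda>k::int. real_of_int k *\<^sub>R c)"
    obtain a where a: "a \<noteq> 0" "span W \<subseteq> {x. a \<bullet> x = 0}"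
      using lowdim_subset_hyperplane[OF W] by blast
    then have "S \<subseteq> {x. a \<bullet> x = 0} + range (\<lambda>k::int. real_of_int k *\<^sub>R c)"
      using S set_plus_mono2[OF order_trans[OF span_superset a(2)] order_refl] by blast
    then show False
      using hyp a(1) by (metis dim_hyperplane subspace_hyperplane)
  qed
  show ?lat
  proof (intro allI impI notI)
    fix V \<Lambda> :: "'a set"
    assume V: "subspace V" "dim V \<le> DIM('a) - 1" and "relative_lattice \<Lambda>"
      and disj: "V \<inter> span \<Lambda> = {0}" and S: "S \<subseteq> V + \<Lambda>"
    obtain A where A: "finite A" "independent A" and \<Lambda>: "\<Lambda> = {(\<Sum>a\<in>A. real_of_int (k a) *\<^sub>R a) | k. True}"
      using \<open>relative_lattice \<Lambda>\<close> unfolding relative_lattice_def by blast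
    show False
    proof (cases "A = {}")
      case True
      have "dim V < DIM('a)"
        using V(2) DIM_positive[where 'a='a] by linarith
      moreover have "S \<subseteq> V + range (\<lambda>k::int. real_of_int k *\<^sub>R 0)"
        using S True \<Lambda> by (simp add: image_constant_conv)
      ultimately show False
        using no_low by blast
    next
      case False
      then obtain a where "a \<in> A"
        by blast
      \<comment> \<open>\<open>a\<close> is the one generator kept discrete. It lies outside
        \<open>W\<close>: otherwise a vector of \<open>V\<close> would lie in the span of the
        lattice, hence be zero, and \<open>a\<close> would depend on the rest of
        \<open>A\<close>.\<close>
      define W where "W = span (V \<union> (A - {a}))"
      have "A \<subseteq> \<Lambda>"
      proof
        fix b assume "b \<in> A"
        then have "b = (\<Sum>a\<in>A. real_of_int (if a = b then 1 else 0) *\<^sub>R a)"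
          using A(1) by (simp add: if_distrib[of "\<lambda>t. real_of_int t *\<^sub>R _"] sum.delta cong: if_cong)
        then show "b \<in> \<Lambda>"
          unfolding \<Lambda> by (intro CollectI exI[of _ "\<lambda>a. if a = b then 1 else 0"] conjI TrueI)
      qed
      have "a \<notin> W"
      proof
        assume "a \<in> W"
        then obtain v s where vs: "v \<in> V" "s \<in> span (A - {a})" "a = v + s"
          unfolding W_def span_Un using V(1) by (auto simp: span_eq_iff[THEN iffD2])
        have "s \<in> span \<Lambda>"
          using vs(2) span_mono[of "A - {a}" \<Lambda>] \<open>A \<subseteq> \<Lambda>\<close> by blast
        moreover have "a \<in> span \<Lambda>"
          using \<open>a \<in> A\<close> \<open>A \<subseteq> \<Lambda>\<close> span_base by blast
        moreover have "v = a - s"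
          using vs(3) by simp
        ultimately have "v \<in> V \<inter> span \<Lambda>"
          using vs(1) span_diff by blast
        then have "a \<in> span (A - {a})"
          using disj vs by auto
        then show False
          using A(2) \<open>a \<in> A\<close> unfolding dependent_def by blast
      qed
      have "dim W < DIM('a)"
      proof -
        have "dim W \<noteq> DIM('a)"
          using \<open>a \<notin> W\<close> dim_eq_full[of "V \<union> (A - {a})"] by (auto simp: W_def span_span)
        then show ?thesis
          using dim_subset_UNIV[of W] by simp
      qed
      moreover have "S \<subseteq> W + range (\<lambda>k::int. real_of_int k *\<^sub>R a)"
      proof
        fix x assume "x \<in> S"
        then obtain v k where "v \<in> V" and x: "x = v + (\<Sum>a\<in>A. real_of_int (k a) *\<^sub>R a)"
          using S unfolding \<Lambda> set_plus_def by blast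
        have "v + (\<Sum>b\<in>A - {a}. real_of_int (k b) *\<^sub>R b) \<in> W"
          unfolding W_def using \<open>v \<in> V\<close> by (intro span_add span_sum span_scale) (auto intro: span_base)
        from set_plus_intro[OF this rangeI[of "\<lambda>k::int. real_of_int k *\<^sub>R a" "k a"]]
        show "x \<in> W + range (\<lambda>k::int. real_of_int k *\<^sub>R a)"
          unfolding x by (subst sum.remove[OF A(1) \<open>a \<in> A\<close>]) (simp only: add_ac)
      qed
      ultimately show False
        using no_low by blast
    qed
  qed
qed

section \<open>Test functions\<close>

lemma C_diff_continuous: "C_diff k f \<Longrightarrow> continuous_on UNIV f"
  by (cases k) (auto intro!: continuous_at_imp_continuous_on differentiable_imp_continuous_within)

lemma frechet_derivative_vanishes_outside_ball:
  assumes "\<And>x. norm x > R \<Longrightarrow> f x = 0" and "norm x > R"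
  shows "frechet_derivative f (at x) v = 0"
proof -
  have "open {x. norm x > R}"
    by (intro open_Collect_less continuous_intros)
  then have "(f has_derivative (\<lambda>_. 0)) (at x)"
    using assms
    by (rule_tac has_derivative_transform_within_open[of "\<lambda>_. 0" "\<lambda>_. 0" x UNIV "{x. norm x > R}"]) auto
  then show ?thesis
    using frechet_derivative_at by metis
qed

lemma bounded_if_continuous_vanishing_outside_ball:
  fixes f :: "'a::euclidean_space \<Rightarrow> real"
  assumes "continuous_on UNIV f" and "\<And>x. norm x > R \<Longrightarrow> f x = 0"
  obtains B where "B \<ge> 0" "\<And>x. \<bar>f x\<bar> \<le> B"
proof -
  have "compact (f ` cball 0 R)"
    using assms(1) by (intro compact_continuous_image) (auto intro: continuous_on_subset)
  then obtain B where B: "\<And>x. x \<in> cball 0 R \<Longrightarrow> \<bar>f x\<bar> \<le> B"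
    using compact_imp_bounded by (force simp: bounded_iff)
  have "\<bar>f x\<bar> \<le> max B 0" for x
    using B[of x] assms(2)[of x] by (cases "norm x \<le> R") auto
  then show ?thesis
    by (intro that[of "max B 0"]) auto
qed

text \<open>\<open>C_diff\<close> controls derivatives one direction at a time; this turns bounds
  along the basis into a bound on the operator norm.\<close>

lemma linear_bound_by_basis_values:
  fixes f :: "'a::euclidean_space \<Rightarrow> real"
  assumes "linear f" and "\<And>i. i \<in> Basis \<Longrightarrow> \<bar>f i\<bar> \<le> B i"
  shows "\<bar>f h\<bar> \<le> (\<Sum>i\<in>Basis. B i) * norm h"
proof -
  have "f h = (\<Sum>i\<in>Basis. (h \<bullet> i) * f i)"
    using linear_sum[OF assms(1), of "\<lambda>i. (h \<bullet> i) *\<^sub>R i" Basis]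
    by (simp add: euclidean_representation linear_scale[OF assms(1)])
  also have "\<bar>\<dots>\<bar> \<le> (\<Sum>i\<in>Basis. norm h * B i)"
    by (rule order_trans[OF sum_abs]) (auto simp: abs_mult intro!: sum_mono mult_mono Basis_le_norm assms(2))
  finally show ?thesis
    by (simp add: sum_distrib_left mult.commute)
qed

lemma C_diff_has_derivative:
  "C_diff (Suc k) f \<Longrightarrow> (f has_derivative frechet_derivative f (at x)) (at x)"
  using frechet_derivative_works by auto

lemma C_diff_1_lipschitz:
  fixes f :: "'a::euclidean_space \<Rightarrow> real"
  assumes f: "C_diff (Suc 0) f" and R: "\<And>x. norm x > R \<Longrightarrow> f x = 0"
  obtains K where "K \<ge> 0" "\<And>x y. \<bar>f x - f y\<bar> \<le> K * norm (x - y)"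
proof -
  have "\<exists>B\<ge>0. \<forall>x. \<bar>frechet_derivative f (at x) i\<bar> \<le> B" for i
  proof -
    have "continuous_on UNIV (\<lambda>x. frechet_derivative f (at x) i)"
      using f by simp
    then show ?thesis
      by (rule bounded_if_continuous_vanishing_outside_ball[OF _ frechet_derivative_vanishes_outside_ball[OF R]]) auto
  qed
  then obtain B where B: "\<And>i. B i \<ge> 0" "\<And>i x. \<bar>frechet_derivative f (at x) i\<bar> \<le> B i"
    by metis
  have "norm (f x - f y) \<le> (\<Sum>i\<in>Basis. B i) * norm (x - y)" for x y
  proof (rule differentiable_bound[of UNIV f "\<lambda>x. frechet_derivative f (at x)"])
    fix x
    show "(f has_derivative frechet_derivative f (at x)) (at x)"
      using C_diff_has_derivative[OF f] .
    then show "onorm (frechet_derivative f (at x)) \<le> (\<Sum>i\<in>Basis. B i)"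
      using linear_bound_by_basis_values[OF has_derivative_linear B(2)]
      by (intro onorm_le) simp
  qed auto
  then show ?thesis
    using B(1) by (intro that[of "\<Sum>i\<in>Basis. B i"]) (auto intro!: sum_nonneg)
qed

section \<open>Second differences of test functions\<close>

definition second_diff :: "('a::ab_group_add \<Rightarrow> real) \<Rightarrow> 'a \<Rightarrow> 'a \<Rightarrow> real" where
  "second_diff f z x = f (x + z) + f (x - z) - 2 * f x"

lemma second_diff_measurable [measurable]:
  fixes f :: "'a::euclidean_space \<Rightarrow> real"
  assumes "f \<in> borel_measurable borel"
  shows "(\<lambda>z. second_diff f z x) \<in> borel_measurable borel"
proof -
  note [measurable] = assms
  show ?thesis
    unfolding second_diff_def by measurable
qed

text \<open>A second difference of \<open>f\<close> is a first difference of the increment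
  \<open>f (y + z) - f y\<close> as a function of \<open>y\<close>. The derivatives of
  \<open>f\<close> are Lipschitz, so that of the increment is of size |z|, and the mean value
  inequality contributes the second factor |z|.\<close>

lemma C_diff_2_second_diff:
  fixes f :: "'a::euclidean_space \<Rightarrow> real"
  assumes f: "C_diff (Suc (Suc 0)) f" and R: "\<And>x. norm x > R \<Longrightarrow> f x = 0"
  obtains K where "K \<ge> 0" "\<And>z x. \<bar>second_diff f z x\<bar> \<le> K * (norm z)\<^sup>2"
proof -
  let ?D = "\<lambda>x. frechet_derivative f (at x)"
  have "\<exists>K\<ge>0. \<forall>x y. \<bar>?D x i - ?D y i\<bar> \<le> K * norm (x - y)" for i
  proof -
    have "C_diff (Suc 0) (\<lambda>x. ?D x i)"
      using f by simp
    then show ?thesis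
      by (rule C_diff_1_lipschitz[OF _ frechet_derivative_vanishes_outside_ball[OF R]]) auto
  qed
  then obtain K where K: "\<And>i. K i \<ge> 0" "\<And>i x y. \<bar>?D x i - ?D y i\<bar> \<le> K i * norm (x - y)"
    by metis
  have der: "(f has_derivative ?D x) (at x)" for x
    using C_diff_has_derivative[OF f] .
  have "\<bar>second_diff f z x\<bar> \<le> (\<Sum>i\<in>Basis. K i) * (norm z)\<^sup>2" for z x
  proof -
    define g where "g y = f (y + z) - f y" for y
    have "norm (g x - g (x - z)) \<le> ((\<Sum>i\<in>Basis. K i) * norm z) * norm (x - (x - z))"
    proof (rule differentiable_bound[of UNIV g "\<lambda>y h. ?D (y + z) h - ?D y h"])
      fix y
      show g': "(g has_derivative (\<lambda>h. ?D (y + z) h - ?D y h)) (at y)"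
        unfolding g_def
        by (intro has_derivative_diff der, rule has_derivative_compose[OF _ der, of "\<lambda>y. y + z" "\<lambda>h. h"])
          (auto intro!: derivative_eq_intros)
      have "\<bar>?D (y + z) h - ?D y h\<bar> \<le> (\<Sum>i\<in>Basis. K i * norm z) * norm h" for h
        using K(2)[of "y + z" _ y]
        by (intro linear_bound_by_basis_values[OF has_derivative_linear[OF g']]) auto
      then show "onorm (\<lambda>h. ?D (y + z) h - ?D y h) \<le> (\<Sum>i\<in>Basis. K i) * norm z"
        by (intro onorm_le) (simp add: sum_distrib_right)
    qed auto
    then show ?thesis
      by (simp add: g_def second_diff_def algebra_simps power2_eq_square)
  qed
  then show ?thesis
    using K(1) by (intro that[of "\<Sum>i\<in>Basis. K i"]) (auto intro!: sum_nonneg)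
qed

lemma test_function_vanishes_outside_ball:
  assumes "test_function f"
  obtains R where "R > 0" "\<And>x. norm x > R \<Longrightarrow> f x = 0"
proof -
  have "bounded {x. f x \<noteq> 0}"
    using assms compact_imp_bounded bounded_subset closure_subset unfolding test_function_def by metis
  then obtain R where "R > 0" "\<And>x. f x \<noteq> 0 \<Longrightarrow> norm x \<le> R"
    by (auto simp: bounded_pos)
  then show ?thesis
    by (intro that[of R]) force+
qed

lemma continuous_compact_support_integrable:
  fixes f :: "'a::euclidean_space \<Rightarrow> real"
  assumes "continuous_on UNIV f" and "\<And>x. norm x > R \<Longrightarrow> f x = 0"
  shows "integrable lborel f"
proof -
  obtain B where B: "B \<ge> 0" "\<And>x. \<bar>f x\<bar> \<le> B"
    using bounded_if_continuous_vanishing_outside_ball[OF assms] by metis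
  have "integrable lborel (\<lambda>x. B * indicator (cball (0::'a) R) x)"
    by (intro integrable_mult_right integrable_real_indicator)
      (auto simp: emeasure_lborel_cball_finite simp flip: infinity_ennreal_def)
  then show ?thesis
    by (rule Bochner_Integration.integrable_bound)
      (use assms B in \<open>auto simp: indicator_def borel_measurable_continuous_onI\<close>)
qed

lemma lborel_integral_shift:
  fixes f :: "'a::euclidean_space \<Rightarrow> real"
  assumes [measurable]: "f \<in> borel_measurable borel"
  shows "(LINT x|lborel. f (c + x)) = (LINT x|lborel. f x)"
  by (subst (2) lborel_distr_plus[symmetric, of c]) (simp add: integral_distr)

lemma lborel_integrable_shift:
  fixes f :: "'a::euclidean_space \<Rightarrow> real"
  assumes "integrable lborel f"
  shows "integrable lborel (\<lambda>x. f (c + x))"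
proof -
  have [measurable]: "f \<in> borel_measurable borel"
    using assms by auto
  show ?thesis
    using assms by (subst (asm) lborel_distr_plus[symmetric, of c]) (simp add: integrable_distr_eq)
qed

lemma test_function_continuous: "test_function f \<Longrightarrow> continuous_on UNIV f"
  unfolding test_function_def using C_diff_continuous by blast

lemma test_function_integrable:
  assumes "test_function f"
  shows "integrable lborel f"
proof -
  obtain R where "\<And>x. norm x > R \<Longrightarrow> f x = 0"
    using test_function_vanishes_outside_ball[OF assms] by metis
  then show ?thesis
    by (rule continuous_compact_support_integrable[OF test_function_continuous[OF assms]])
qed

lemma test_function_measurable [measurable_dest]:
  "test_function f \<Longrightarrow> f \<in> borel_measurable borel"
  by (intro borel_measurable_continuous_onI test_function_continuous)

lemma test_function_lipschitz:
  assumes "test_function f"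
  obtains K where "K \<ge> 0" "\<And>x y. \<bar>f x - f y\<bar> \<le> K * norm (x - y)"
proof -
  obtain R where R: "\<And>x. norm x > R \<Longrightarrow> f x = 0"
    using test_function_vanishes_outside_ball[OF assms] by metis
  have "C_diff (Suc 0) f"
    using assms unfolding test_function_def by blast
  then show ?thesis
    by (rule C_diff_1_lipschitz[of f R]) (use R that in auto)
qed

lemma test_function_second_diff:
  assumes "test_function f"
  obtains K where "K \<ge> 0" "\<And>z x. \<bar>second_diff f z x\<bar> \<le> K * min ((norm z)\<^sup>2) 1"
proof -
  obtain R where R: "\<And>x. norm x > R \<Longrightarrow> f x = 0"
    using test_function_vanishes_outside_ball[OF assms] by metis
  obtain K where K: "K \<ge> 0" "\<And>z x. \<bar>second_diff f z x\<bar> \<le> K * (norm z)\<^sup>2"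
    using assms C_diff_2_second_diff[of f, OF _ R] unfolding test_function_def by metis
  obtain B where B: "B \<ge> 0" "\<And>x. \<bar>f x\<bar> \<le> B"
    using bounded_if_continuous_vanishing_outside_ball[OF test_function_continuous[OF assms] R] by metis
  have "\<bar>second_diff f z x\<bar> \<le> (K + 4 * B) * min ((norm z)\<^sup>2) 1" for z x
  proof (cases "(norm z)\<^sup>2 \<le> 1")
    case True
    then show ?thesis
      using K(2)[of z x] B(1) by (auto simp: distrib_right min_def intro: order_trans)
  next
    case False
    have "\<bar>second_diff f z x\<bar> \<le> 4 * B"
      using B(2)[of "x + z"] B(2)[of "x - z"] B(2)[of x] unfolding second_diff_def by linarith
    then show ?thesis
      using False K(1) by simp
  qed
  then show ?thesis
    using K B by (intro that[of "K + 4 * B"]) auto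
qed

lemma integral_bound_on_ball:
  fixes f :: "'a::euclidean_space \<Rightarrow> real"
  assumes [measurable]: "f \<in> borel_measurable borel"
    and "\<And>x. \<bar>f x\<bar> \<le> B" and "\<And>x. norm x > R \<Longrightarrow> f x = 0"
  shows "(LINT x|lborel. \<bar>f x\<bar>) \<le> B * measure lborel (cball (0::'a) R)"
proof -
  have "integrable lborel (\<lambda>x. B * indicator (cball (0::'a) R) x)"
    by (intro integrable_mult_right integrable_real_indicator)
      (auto simp: emeasure_lborel_cball_finite simp flip: infinity_ennreal_def)
  then have "(LINT x|lborel. \<bar>f x\<bar>) \<le> (LINT x|lborel. B * indicator (cball (0::'a) R) x)"
    by (rule Bochner_Integration.integral_mono') (use assms in \<open>auto simp: indicator_def intro: order_trans[OF abs_ge_zero]\<close>)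
  then show ?thesis
    by simp
qed

lemma second_diff_integrable:
  assumes "test_function f"
  shows "integrable lborel (second_diff f z)"
  using lborel_integrable_shift[OF test_function_integrable[OF assms], of z]
    lborel_integrable_shift[OF test_function_integrable[OF assms], of "- z"]
    test_function_integrable[OF assms]
  by (simp add: second_diff_def[abs_def] add.commute)

text \<open>For |z| at most 1 the second difference still lives in the ball of radius
  \<open>R + 1\<close>, where the pointwise bound is integrated. For larger |z| no fixed ball
  contains its support, and translation invariance bounds the norm by four times the L1 norm of
  \<open>f\<close>.\<close>

lemma second_diff_L1_bound:
  fixes f :: "'a::euclidean_space \<Rightarrow> real"
  assumes f: "test_function f"
  obtains K where "K \<ge> 0" "\<And>z. (LINT x|lborel. \<bar>second_diff f z x\<bar>) \<le> K * min ((norm z)\<^sup>2) 1"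
proof -
  have [measurable]: "f \<in> borel_measurable borel"
    using f by measurable
  obtain R where R: "\<And>x. norm x > R \<Longrightarrow> f x = 0"
    using test_function_vanishes_outside_ball[OF f] by metis
  obtain K where K: "K \<ge> 0" "\<And>z x. \<bar>second_diff f z x\<bar> \<le> K * min ((norm z)\<^sup>2) 1"
    using test_function_second_diff[OF f] by metis
  define A where "A = K * measure lborel (cball (0::'a) (R + 1))"
  define I where "I = (LINT x|lborel. \<bar>f x\<bar>)"
  have "A \<ge> 0" "I \<ge> 0"
    using K(1) by (auto simp: A_def I_def)
  have "(LINT x|lborel. \<bar>second_diff f z x\<bar>) \<le> (A + 4 * I) * min ((norm z)\<^sup>2) 1" for z
  proof (cases "norm z \<le> 1")
    case True
    have "(LINT x|lborel. \<bar>second_diff f z x\<bar>) \<le> (K * min ((norm z)\<^sup>2) 1) * measure lborel (cball (0::'a) (R + 1))"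
    proof (rule integral_bound_on_ball)
      show "second_diff f z \<in> borel_measurable borel"
        unfolding second_diff_def[abs_def] by measurable
      show "\<bar>second_diff f z x\<bar> \<le> K * min ((norm z)\<^sup>2) 1" for x
        by (rule K)
      show "second_diff f z x = 0" if "norm x > R + 1" for x
      proof -
        have "norm (x + z) > R" "norm (x - z) > R" "norm x > R"
          using that True norm_diff_ineq[of x z] norm_diff_ineq[of x "- z"] by auto
        then show ?thesis
          using R by (simp add: second_diff_def)
      qed
    qed
    also have "\<dots> = A * min ((norm z)\<^sup>2) 1"
      by (simp add: A_def)
    also have "\<dots> \<le> (A + 4 * I) * min ((norm z)\<^sup>2) 1"
      using \<open>I \<ge> 0\<close> by (intro mult_right_mono) auto
    finally show ?thesis .
  next
    case False
    have int: "integrable lborel (\<lambda>x. \<bar>f x\<bar>)"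
      using test_function_integrable[OF f] by simp
    note shift = lborel_integrable_shift[OF int] lborel_integral_shift[of "\<lambda>x. \<bar>f x\<bar>"]
    have "(LINT x|lborel. \<bar>second_diff f z x\<bar>) \<le> (LINT x|lborel. \<bar>f (z + x)\<bar> + \<bar>f (- z + x)\<bar> + 2 * \<bar>f x\<bar>)"
    proof (rule integral_mono)
      show "integrable lborel (\<lambda>x. \<bar>second_diff f z x\<bar>)"
        using second_diff_integrable[OF f] by (rule integrable_abs)
      show "integrable lborel (\<lambda>x. \<bar>f (z + x)\<bar> + \<bar>f (- z + x)\<bar> + 2 * \<bar>f x\<bar>)"
        using int shift(1) by (intro Bochner_Integration.integrable_add integrable_mult_right)
    qed (auto simp: second_diff_def add.commute)
    also have "\<dots> = 4 * I"
      using int shift(1)[of z] shift(1)[of "- z"] shift(2)[of z] shift(2)[of "- z"] by (simp add: I_def)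
    also have "\<dots> \<le> (A + 4 * I) * min ((norm z)\<^sup>2) 1"
      using False \<open>A \<ge> 0\<close> by simp
    finally show ?thesis .
  qed
  then show ?thesis
    using \<open>A \<ge> 0\<close> \<open>I \<ge> 0\<close> by (intro that[of "A + 4 * I"]) auto
qed

text \<open>Same support argument as for second differences; it yields the Lipschitz constant of the
  pairings of a bounded function with translates.\<close>

lemma first_diff_L1_bound:
  fixes f :: "'a::euclidean_space \<Rightarrow> real"
  assumes f: "test_function f"
  obtains K where "K \<ge> 0"
    "\<And>h. norm h \<le> 1 \<Longrightarrow> (LINT x|lborel. \<bar>f (x + h) - f x\<bar>) \<le> K * norm h"
proof -
  have [measurable]: "f \<in> borel_measurable borel"
    using f by measurable
  obtain R where R: "\<And>x. norm x > R \<Longrightarrow> f x = 0"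
    using test_function_vanishes_outside_ball[OF f] by metis
  obtain K where K: "K \<ge> 0" "\<And>x y. \<bar>f x - f y\<bar> \<le> K * norm (x - y)"
    using test_function_lipschitz[OF f] by metis
  have "(LINT x|lborel. \<bar>f (x + h) - f x\<bar>) \<le> (K * norm h) * measure lborel (cball (0::'a) (R + 1))"
    if h: "norm h \<le> 1" for h
  proof (rule integral_bound_on_ball)
    show "\<bar>f (x + h) - f x\<bar> \<le> K * norm h" for x
      using K(2)[of "x + h" x] by simp
    show "f (x + h) - f x = 0" if "norm x > R + 1" for x
    proof -
      have "norm (x + h) > R" "norm x > R"
        using that h norm_diff_ineq[of x h] by auto
      then show ?thesis
        using R by simp
    qed
  qed measurable
  then show ?thesis
    using K(1) by (intro that[of "K * measure lborel (cball (0::'a) (R + 1))"]) (auto simp: mult_ac)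
qed

lemma C_diff_shift: "C_diff k f \<Longrightarrow> C_diff k (\<lambda>y. f (x + y))"
proof (induction k arbitrary: f)
  case 0
  then show ?case
    by (auto intro!: continuous_on_compose2[of UNIV f UNIV "(+) x"] continuous_intros)
next
  case (Suc k)
  have der: "((\<lambda>y. f (x + y)) has_derivative frechet_derivative f (at (x + y))) (at y)" for y
    by (rule has_derivative_compose[OF _ C_diff_has_derivative[OF Suc.prems], of "\<lambda>y. x + y" "\<lambda>h. h"])
      (auto intro!: derivative_eq_intros)
  then have "frechet_derivative (\<lambda>y. f (x + y)) (at y) = frechet_derivative f (at (x + y))" for y
    using frechet_derivative_at by metis
  with der Suc.prems Suc.IH[of "\<lambda>x. frechet_derivative f (at x) v" for v] show ?case
    by (auto simp: differentiable_def)
qed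

lemma test_function_shift:
  fixes f :: "'a::euclidean_space \<Rightarrow> real"
  assumes "test_function f"
  shows "test_function (\<lambda>y. f (x + y))"
proof -
  obtain R where R: "\<And>x. norm x > R \<Longrightarrow> f x = 0"
    using test_function_vanishes_outside_ball[OF assms] by metis
  have "norm y \<le> R + norm x" if "f (x + y) \<noteq> 0" for y
    using that R[of "x + y"] norm_diff_ineq[of y x] by (force simp: add.commute not_less[symmetric])
  then have "bounded {y. f (x + y) \<noteq> 0}"
    by (auto simp: bounded_iff)
  then show ?thesis
    using assms C_diff_shift by (auto simp: test_function_def)
qed

section \<open>Smooth bump functions approximating boxes\<close>

text \<open>The classical flat function exp(-1/t), extended by 0, is the case \<open>p = 1\<close>;
  the polynomial factor in 1/t makes the family stable under differentiation.\<close>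

definition flat_exp :: "real poly \<Rightarrow> real \<Rightarrow> real" where
  "flat_exp p t = (if t > 0 then poly p (1 / t) * exp (- (1 / t)) else 0)"

lemma poly_times_exp_minus_tendsto_0: "((\<lambda>s::real. poly p s * exp (- s)) \<longlongrightarrow> 0) at_top"
proof -
  have "((\<lambda>s::real. \<Sum>i\<le>degree p. coeff p i * (s ^ i / exp s)) \<longlongrightarrow> (\<Sum>i\<le>degree p. coeff p i * 0)) at_top"
    by (intro tendsto_sum tendsto_mult tendsto_const tendsto_power_div_exp_0)
  then show ?thesis
    by (simp add: poly_altdef sum_distrib_right exp_minus divide_inverse mult.assoc)
qed

text \<open>By the chain rule the derivative of P(1/t) exp(-1/t) is t^(-2) (P - P')(1/t) exp(-1/t),
  and the factor t^(-2) is the monomial \<open>[:0, 0, 1:]\<close> at 1/t. At the origin the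
  difference quotient tends to 0 because exponential decay beats any polynomial.\<close>

lemma flat_exp_has_derivative:
  "(flat_exp p has_real_derivative flat_exp ([:0, 0, 1:] * (p - pderiv p)) t) (at t)"
proof (cases t "0::real" rule: linorder_cases)
  case less
  have "(flat_exp p has_real_derivative 0) (at t)"
    using less
    by (rule_tac has_field_derivative_transform_within_open[of "\<lambda>_. 0" 0 t "{..<0}"])
      (auto simp: flat_exp_def)
  then show ?thesis
    using less by (simp add: flat_exp_def)
next
  case greater
  have "((\<lambda>t. poly p (1 / t) * exp (- (1 / t))) has_real_derivative
      flat_exp ([:0, 0, 1:] * (p - pderiv p)) t) (at t)"
    using greater
    by (auto intro!: derivative_eq_intros DERIV_chain2[OF poly_DERIV]
        simp: flat_exp_def field_simps power2_eq_square)
  then show ?thesis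
    by (rule has_field_derivative_transform_within_open[of _ _ t "{0<..}" "flat_exp p"])
      (use greater in \<open>auto simp: flat_exp_def\<close>)
next
  case equal
  \<comment> \<open>Multiplying the polynomial by its variable, as \<open>pCons 0 p\<close> does,
    accounts for the division by \<open>h\<close> in the difference quotient.\<close>
  have "((\<lambda>h. poly (pCons 0 p) (inverse h) * exp (- inverse h)) \<longlongrightarrow> 0) (at_right 0)"
    by (rule filterlim_compose[OF poly_times_exp_minus_tendsto_0 filterlim_inverse_at_top_right])
  then have right: "((\<lambda>h. flat_exp p h / h) \<longlongrightarrow> 0) (at_right 0)"
    by (rule Lim_transform_eventually)
      (auto simp: eventually_at_right_field flat_exp_def field_simps intro: exI[of _ 1])
  have left: "((\<lambda>h. flat_exp p h / h) \<longlongrightarrow> 0) (at_left 0)"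
    by (rule Lim_transform_eventually[OF tendsto_const])
      (auto simp: eventually_at_left_field flat_exp_def intro: exI[of _ "-1"])
  have "((\<lambda>h. (flat_exp p (0 + h) - flat_exp p 0) / h) \<longlongrightarrow> 0) (at 0)"
    using filterlim_split_at[OF left right] by (simp add: flat_exp_def)
  then show ?thesis
    using equal by (simp add: DERIV_def flat_exp_def)
qed

text \<open>An algebra containing the derivatives of its generators is closed under all directional
  derivatives, so its members are smooth without any formula for higher derivatives.\<close>

inductive flat_exp_algebra :: "('a::euclidean_space \<Rightarrow> real) \<Rightarrow> bool" where
  const: "flat_exp_algebra (\<lambda>x. c)"
| base: "flat_exp_algebra (\<lambda>x. flat_exp p (a + b \<bullet> x))"
| add: "flat_exp_algebra f \<Longrightarrow> flat_exp_algebra g \<Longrightarrow> flat_exp_algebra (\<lambda>x. f x + g x)"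
| mult: "flat_exp_algebra f \<Longrightarrow> flat_exp_algebra g \<Longrightarrow> flat_exp_algebra (\<lambda>x. f x * g x)"

lemma flat_exp_algebra_derivative:
  assumes "flat_exp_algebra f"
  shows "\<exists>f'. (\<forall>x. (f has_derivative f' x) (at x)) \<and> (\<forall>v. flat_exp_algebra (\<lambda>x. f' x v))"
  using assms
proof induction
  case (const c)
  show ?case
    by (rule exI[of _ "\<lambda>_ _. 0"]) (auto intro: flat_exp_algebra.const)
next
  case (base p a b)
  let ?q = "[:0, 0, 1:] * (p - pderiv p)"
  have "((\<lambda>x. flat_exp p (a + b \<bullet> x)) has_derivative (\<lambda>v. flat_exp ?q (a + b \<bullet> x) * (b \<bullet> v))) (at x)" for x
    by (rule has_derivative_compose[OF _ flat_exp_has_derivative[unfolded has_field_derivative_def]])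
      (auto intro!: derivative_eq_intros)
  then show ?case
    by (intro exI[of _ "\<lambda>x v. flat_exp ?q (a + b \<bullet> x) * (b \<bullet> v)"])
      (auto intro: flat_exp_algebra.intros)
next
  case (add f g)
  then obtain f' g' where "\<And>x. (f has_derivative f' x) (at x)" "\<And>v. flat_exp_algebra (\<lambda>x. f' x v)"
    "\<And>x. (g has_derivative g' x) (at x)" "\<And>v. flat_exp_algebra (\<lambda>x. g' x v)"
    by blast
  then show ?case
    by (intro exI[of _ "\<lambda>x v. f' x v + g' x v"]) (auto intro!: has_derivative_add flat_exp_algebra.intros)
next
  case (mult f g)
  then obtain f' g' where "\<And>x. (f has_derivative f' x) (at x)" "\<And>v. flat_exp_algebra (\<lambda>x. f' x v)"
    "\<And>x. (g has_derivative g' x) (at x)" "\<And>v. flat_exp_algebra (\<lambda>x. g' x v)"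
    by blast
  with mult.hyps show ?case
    by (intro exI[of _ "\<lambda>x v. f x * g' x v + f' x v * g x"]) (auto intro!: has_derivative_mult flat_exp_algebra.intros)
qed

lemma flat_exp_algebra_C_diff: "flat_exp_algebra f \<Longrightarrow> C_diff k f"
proof (induction k arbitrary: f)
  case 0
  then obtain f' where "\<And>x. (f has_derivative f' x) (at x)"
    using flat_exp_algebra_derivative by metis
  then show ?case
    by (auto intro!: continuous_at_imp_continuous_on has_derivative_continuous)
next
  case (Suc k)
  then obtain f' where f': "\<And>x. (f has_derivative f' x) (at x)" "\<And>v. flat_exp_algebra (\<lambda>x. f' x v)"
    using flat_exp_algebra_derivative by metis
  then have "frechet_derivative f (at x) = f' x" for x
    using frechet_derivative_at by metis
  with f' Suc.IH show ?case
    by (auto simp: differentiable_def)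
qed

text \<open>Each factor vanishes beyond one face of the box, so the product is smooth and vanishes
  off the box; growing \<open>n\<close> steepens the factors so that they tend to 1 inside.\<close>

definition box_bump :: "'a::euclidean_space \<Rightarrow> 'a \<Rightarrow> nat \<Rightarrow> 'a \<Rightarrow> real" where
  "box_bump l u n x =
     (\<Prod>i\<in>Basis. flat_exp 1 (real n * (x \<bullet> i - l \<bullet> i)) * flat_exp 1 (real n * (u \<bullet> i - x \<bullet> i)))"

lemma flat_exp_1_bounds: "0 \<le> flat_exp 1 t" "flat_exp 1 t \<le> 1"
  by (auto simp: flat_exp_def)

lemma box_bump_bounds: "0 \<le> box_bump l u n x" "box_bump l u n x \<le> 1"
  unfolding box_bump_def
  by (auto intro!: prod_nonneg prod_le_1 mult_nonneg_nonneg mult_le_one flat_exp_1_bounds)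

lemma box_bump_outside: "x \<notin> box l u \<Longrightarrow> box_bump l u n x = 0"
  by (force simp: box_bump_def mem_box flat_exp_def zero_less_mult_iff)

lemma box_bump_test_function: "test_function (box_bump l u n)"
proof -
  have lin: "flat_exp_algebra (\<lambda>x. flat_exp 1 (real n * (x \<bullet> i - l \<bullet> i)))"
    "flat_exp_algebra (\<lambda>x. flat_exp 1 (real n * (u \<bullet> i - x \<bullet> i)))" for i
    using flat_exp_algebra.base[of 1 "- (real n * (l \<bullet> i))" "real n *\<^sub>R i"]
      flat_exp_algebra.base[of 1 "real n * (u \<bullet> i)" "- (real n *\<^sub>R i)"]
    by (simp_all add: algebra_simps inner_commute)
  have "flat_exp_algebra (\<lambda>x. \<Prod>i\<in>I. flat_exp 1 (real n * (x \<bullet> i - l \<bullet> i)) * flat_exp 1 (real n * (u \<bullet> i - x \<bullet> i)))"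
    if "finite I" for I
    using that by induction (auto intro!: flat_exp_algebra.const flat_exp_algebra.mult lin)
  then have "flat_exp_algebra (box_bump l u n)"
    unfolding box_bump_def[abs_def] by simp
  moreover have "bounded {x. box_bump l u n x \<noteq> 0}"
    by (rule bounded_subset[OF bounded_box[of l u]]) (use box_bump_outside in blast)
  ultimately show ?thesis
    by (auto simp: test_function_def flat_exp_algebra_C_diff)
qed

lemma box_bump_tendsto: "(\<lambda>n. box_bump l u n x) \<longlonglongrightarrow> indicator (box l u) x"
proof (cases "x \<in> box l u")
  case True
  have lim: "(\<lambda>n. flat_exp 1 (real n * s)) \<longlonglongrightarrow> 1" if "s > 0" for s
  proof -
    have "(\<lambda>n. exp (- (1 / (real n * s)))) \<longlonglongrightarrow> exp (- 0)"
      using that by (intro tendsto_intros tendsto_divide_0[OF tendsto_const]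
          filterlim_at_top_imp_at_infinity filterlim_at_top_mult_tendsto_pos[OF tendsto_const] filterlim_real_sequentially)
    \<comment> \<open>Equality starts at \<open>n = 1\<close>: for \<open>n = 0\<close> division by
      zero makes the exponential 1, while \<open>flat_exp 1 0\<close> is 0.\<close>
    moreover have "\<forall>\<^sub>F n in sequentially. exp (- (1 / (real n * s))) = flat_exp 1 (real n * s)"
      using that by (auto simp: flat_exp_def eventually_sequentially intro!: exI[of _ 1])
    ultimately show ?thesis
      by (simp add: Lim_transform_eventually)
  qed
  have "(\<lambda>n. box_bump l u n x) \<longlonglongrightarrow> (\<Prod>i\<in>(Basis::'a set). 1 * 1)"
    unfolding box_bump_def using True
    by (intro tendsto_prod tendsto_mult lim) (auto simp: mem_box)
  then show ?thesis
    using True by simp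
qed (simp add: box_bump_outside)

section \<open>The operator on bounded functions\<close>

lemma locally_lipschitz_continuous:
  fixes U :: "'a::real_normed_vector \<Rightarrow> real"
  assumes "\<And>x h. norm h \<le> 1 \<Longrightarrow> \<bar>U (x + h) - U x\<bar> \<le> L * norm h"
  shows "continuous_on UNIV U"
proof (intro continuous_at_imp_continuous_on ballI)
  fix x
  have "((\<lambda>h. L * norm h) \<longlongrightarrow> 0) (at 0)"
    by (intro tendsto_mult_right_zero tendsto_norm_zero tendsto_ident_at)
  moreover have "\<forall>\<^sub>F h in at (0::'a). norm (U (x + h) - U x) \<le> L * norm h"
    unfolding eventually_at using assms by (intro exI[of _ 1]) (auto simp: less_imp_le)
  ultimately have "((\<lambda>h. U (x + h) - U x) \<longlongrightarrow> 0) (at 0)"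
    by (intro Lim_null_comparison[of "\<lambda>h. U (x + h) - U x" "\<lambda>h. L * norm h"]) auto
  then have "((\<lambda>h. U (x + h)) \<longlongrightarrow> U x) (at 0)"
    using LIM_zero_iff by blast
  then show "isCont U x"
    by (simp add: isCont_iff)
qed

text \<open>The measure is carried by all Borel sets, with the origin as a null set, so that Borel
  functions are integrated directly; symmetry as invariance of the image measure is the form that
  transforms integrals.\<close>

locale levy_measure =
  fixes \<nu> :: "'a::euclidean_space measure"
  assumes sets_eq_borel [measurable_cong]: "sets \<nu> = sets borel"
    and null_zero: "emeasure \<nu> {0} = 0"
    and symmetric: "distr \<nu> borel uminus = \<nu>"
    and integrable_min: "integrable \<nu> (\<lambda>z. min ((norm z)\<^sup>2) 1)"
begin

lemma space_eq_UNIV [simp]: "space \<nu> = UNIV"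
  using sets_eq_imp_space_eq[OF sets_eq_borel] by simp

text \<open>Chebyshev's inequality for \<open>min ((norm z)\<^sup>2) 1\<close>, which is at least
  \<open>min (r\<^sup>2) 1\<close> outside the ball.\<close>

lemma emeasure_outside_ball_finite:
  assumes "r > 0"
  shows "emeasure \<nu> {z. norm z > r} < \<infinity>"
proof -
  have int: "integrable \<nu> (\<lambda>z. min ((norm z)\<^sup>2) 1 / min (r\<^sup>2) 1)"
    using integrable_min by simp
  have le: "norm (indicator {z::'a. norm z > r} z :: real) \<le> norm (min ((norm z)\<^sup>2) 1 / min (r\<^sup>2) 1)" for z :: 'a
  proof -
    have "min (r\<^sup>2) 1 \<le> min ((norm z)\<^sup>2) 1" if "norm z > r"
      using that assms by (intro min.mono) (auto intro: power_mono)
    moreover have "min (r\<^sup>2) 1 > 0"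
      using assms by simp
    ultimately show ?thesis
      by (auto simp: indicator_def)
  qed
  have "integrable \<nu> (indicator {z. norm z > r} :: 'a \<Rightarrow> real)"
    by (rule Bochner_Integration.integrable_bound[OF int _ AE_I2[OF le]]) measurable
  then show ?thesis
    by (simp add: integrable_indicator_iff)
qed

sublocale sigma_finite_measure \<nu>
proof
  \<comment> \<open>Away from the null origin, the sets |z| > 1/(n+1) exhaust the space.\<close>
  let ?A = "insert {0::'a} (range (\<lambda>n. {z. norm z > 1 / real (Suc n)}))"
  have "\<exists>n. 1 / real (Suc n) < norm z" if "z \<noteq> 0" for z :: 'a
    using that nat_approx_posE[of "norm z"] by auto
  then have "\<Union>?A = space \<nu>"
    by auto
  moreover have "?A \<subseteq> sets \<nu>"
    by (auto simp: sets_eq_borel)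
  moreover have "\<forall>a\<in>?A. emeasure \<nu> a \<noteq> \<infinity>"
    using emeasure_outside_ball_finite[of "1 / real (Suc n)" for n] null_zero by (auto simp: less_top)
  ultimately show "\<exists>A. countable A \<and> A \<subseteq> sets \<nu> \<and> \<Union>A = space \<nu> \<and> (\<forall>a\<in>A. emeasure \<nu> a \<noteq> \<infinity>)"
    by (intro exI[of _ ?A]) auto
qed

sublocale lborel_nu: pair_sigma_finite \<nu> "lborel :: 'a measure" ..

lemma integral_uminus:
  fixes f :: "'a \<Rightarrow> real"
  assumes [measurable]: "f \<in> borel_measurable borel"
  shows "(LINT z|\<nu>. f (- z)) = (LINT z|\<nu>. f z)"
  by (subst (2) symmetric[symmetric]) (simp add: integral_distr)

text \<open>Away from the origin first differences are integrable by themselves, so the integral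
  equals its reflection and may be averaged with it; the average of the integrands is half a second
  difference.\<close>

lemma truncated_levy_integral:
  assumes \<psi>: "test_function \<psi>" and "r > 0"
  shows "(LINT z:{z. norm z > r}|\<nu>. \<psi> (x + z) - \<psi> x) =
    1 / 2 * (LINT z|\<nu>. indicator {z. norm z > r} z * second_diff \<psi> z x)"
proof -
  have [measurable]: "\<psi> \<in> borel_measurable borel"
    using \<psi> by measurable
  obtain R where R: "\<And>x. norm x > R \<Longrightarrow> \<psi> x = 0"
    using test_function_vanishes_outside_ball[OF \<psi>] by metis
  obtain B where B: "B \<ge> 0" "\<And>x. \<bar>\<psi> x\<bar> \<le> B"
    using bounded_if_continuous_vanishing_outside_ball[OF test_function_continuous[OF \<psi>] R] by metis
  define g where "g z = indicator {z. norm z > r} z * (\<psi> (x + z) - \<psi> x)" for z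
  have [measurable]: "g \<in> borel_measurable borel"
    unfolding g_def[abs_def] by measurable
  have ind: "integrable \<nu> (indicator {z. norm z > r} :: 'a \<Rightarrow> real)"
    using emeasure_outside_ball_finite[OF \<open>r > 0\<close>] by (simp add: integrable_indicator_iff)
  have int: "integrable \<nu> (\<lambda>z. g (s z))" if [measurable]: "s \<in> borel_measurable borel" and s: "\<And>z. norm (s z) = norm z"
    for s
  proof (rule Bochner_Integration.integrable_bound[OF integrable_mult_right[OF ind, of "2 * B"]])
    show "AE z in \<nu>. norm (g (s z)) \<le> norm (2 * B * indicator {z. norm z > r} z)"
    proof (rule AE_I2)
      fix z
      have "\<bar>\<psi> (x + s z) - \<psi> x\<bar> \<le> 2 * B"
        using B(2)[of "x + s z"] B(2)[of x] by linarith
      then show "norm (g (s z)) \<le> norm (2 * B * indicator {z. norm z > r} z)"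
        using B(1) by (auto simp: g_def indicator_def s)
    qed
  qed measurable
  have "(LINT z|\<nu>. g z) + (LINT z|\<nu>. g (- z)) = (LINT z|\<nu>. g z + g (- z))"
    using int[of "\<lambda>z. z"] int[of uminus] by (subst Bochner_Integration.integral_add) auto
  also have "\<dots> = (LINT z|\<nu>. indicator {z. norm z > r} z * second_diff \<psi> z x)"
    by (rule Bochner_Integration.integral_cong) (auto simp: g_def second_diff_def indicator_def algebra_simps)
  finally show ?thesis
    using integral_uminus[of g] by (simp add: g_def set_lebesgue_integral_def)
qed

text \<open>Second differences are dominated by a multiple of the integrable
  \<open>min ((norm z)\<^sup>2) 1\<close>, so the truncation is removed by dominated convergence and
  the principal value becomes an absolutely convergent integral.\<close>

lemma levy_op_eq_second_diff:
  assumes \<psi>: "test_function \<psi>"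
  shows "levy_op \<nu> \<psi> x = 1 / 2 * (LINT z|\<nu>. second_diff \<psi> z x)"
proof -
  have [measurable]: "\<psi> \<in> borel_measurable borel"
    using \<psi> by measurable
  obtain K where K: "K \<ge> 0" "\<And>z x. \<bar>second_diff \<psi> z x\<bar> \<le> K * min ((norm z)\<^sup>2) 1"
    using test_function_second_diff[OF \<psi>] by metis
  have "((\<lambda>r. LINT z|\<nu>. indicator {z. norm z > r} z * second_diff \<psi> z x) \<longlongrightarrow>
      (LINT z|\<nu>. second_diff \<psi> z x)) (at_right 0)"
  proof (rule tendsto_at_right_sequentially[of 0 1])
    fix S :: "nat \<Rightarrow> real"
    assume S: "\<And>n. 0 < S n" "S \<longlonglongrightarrow> 0"
    show "(\<lambda>n. LINT z|\<nu>. indicator {z. norm z > S n} z * second_diff \<psi> z x) \<longlonglongrightarrow>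
      (LINT z|\<nu>. second_diff \<psi> z x)"
    proof (rule integral_dominated_convergence[where w = "\<lambda>z. K * min ((norm z)\<^sup>2) 1"])
      show "AE z in \<nu>. (\<lambda>n. indicator {z. norm z > S n} z * second_diff \<psi> z x) \<longlonglongrightarrow> second_diff \<psi> z x"
      proof (rule AE_I2)
        fix z :: 'a
        show "(\<lambda>n. indicator {z. norm z > S n} z * second_diff \<psi> z x) \<longlonglongrightarrow> second_diff \<psi> z x"
        \<comment> \<open>The truncated integrand never reaches the origin, but the second
          difference vanishes there.\<close>
        proof (cases "z = 0")
          case False
          then have "\<forall>\<^sub>F n in sequentially. S n < norm z"
            using order_tendstoD(2)[OF S(2)] by simp
          then have "\<forall>\<^sub>F n in sequentially. second_diff \<psi> z x = indicator {z. norm z > S n} z * second_diff \<psi> z x"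
            by eventually_elim simp
          then show ?thesis
            by (rule Lim_transform_eventually[OF tendsto_const])
        qed (simp add: second_diff_def)
      qed
      show "AE z in \<nu>. norm (indicator {z. norm z > S n} z * second_diff \<psi> z x) \<le> K * min ((norm z)\<^sup>2) 1" for n
        using K by (intro AE_I2) (auto simp: indicator_def simp del: min_less_iff_conj)
    qed (use integrable_min in auto)
  qed simp
  then have "((\<lambda>r. LINT z:{z. norm z > r}|\<nu>. \<psi> (x + z) - \<psi> x) \<longlongrightarrow>
      1 / 2 * (LINT z|\<nu>. second_diff \<psi> z x)) (at_right 0)"
    by (intro Lim_transform_eventually[OF tendsto_mult[OF tendsto_const[of "1 / 2"]]])
      (auto simp: eventually_at_right_field truncated_levy_integral[OF \<psi>] intro!: exI[of _ 1])
  then show ?thesis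
    unfolding levy_op_def by (intro tendsto_Lim) auto
qed

text \<open>Fubini's theorem applies because the inner L1 norm is at most a multiple of
  \<open>min ((norm z)\<^sup>2) 1\<close>, by the L1 estimate for second differences.\<close>

lemma pairing_levy_op:
  assumes \<psi>: "test_function \<psi>" and [measurable]: "u \<in> borel_measurable borel"
    and u: "\<And>x. \<bar>u x\<bar> \<le> C"
  shows "(LINT x|lborel. u x * levy_op \<nu> \<psi> x) =
    1 / 2 * (LINT z|\<nu>. LINT x|lborel. u x * second_diff \<psi> z x)"
proof -
  have [measurable]: "\<psi> \<in> borel_measurable borel"
    using \<psi> by measurable
  have "C \<ge> 0"
    using u[of 0] by linarith
  obtain K where K: "K \<ge> 0" "\<And>z. (LINT x|lborel. \<bar>second_diff \<psi> z x\<bar>) \<le> K * min ((norm z)\<^sup>2) 1"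
    using second_diff_L1_bound[OF \<psi>] by metis
  have int: "integrable lborel (\<lambda>x. u x * second_diff \<psi> z x)" for z
    by (rule Bochner_Integration.integrable_bound[OF integrable_mult_right[OF second_diff_integrable[OF \<psi>, of z], of C]])
      (use u \<open>C \<ge> 0\<close> in \<open>auto simp: abs_mult second_diff_def[abs_def] intro!: mult_right_mono\<close>)
  have "integrable (\<nu> \<Otimes>\<^sub>M lborel) (\<lambda>(z, x). u x * second_diff \<psi> z x)"
  proof (rule lborel_nu.Fubini_integrable)
    show [measurable]: "(\<lambda>(z, x). u x * second_diff \<psi> z x) \<in> borel_measurable (\<nu> \<Otimes>\<^sub>M lborel)"
      unfolding second_diff_def by measurable
    show "integrable \<nu> (\<lambda>z. LINT x|lborel. norm (case (z, x) of (z, x) \<Rightarrow> u x * second_diff \<psi> z x))"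
    proof (rule Bochner_Integration.integrable_bound[OF integrable_mult_right[OF integrable_min, of "C * K"]])
      show "AE z in \<nu>. norm (LINT x|lborel. norm (case (z, x) of (z, x) \<Rightarrow> u x * second_diff \<psi> z x))
        \<le> norm (C * K * min ((norm z)\<^sup>2) 1)"
      proof (rule AE_I2)
        fix z :: 'a
        have "(LINT x|lborel. \<bar>u x * second_diff \<psi> z x\<bar>) \<le> (LINT x|lborel. C * \<bar>second_diff \<psi> z x\<bar>)"
          using u by (intro integral_mono integrable_abs int integrable_mult_right second_diff_integrable \<psi>)
            (auto simp: abs_mult intro!: mult_right_mono)
        also have "\<dots> \<le> C * (K * min ((norm z)\<^sup>2) 1)"
          using K(2)[of z] \<open>C \<ge> 0\<close> by (auto intro!: mult_left_mono simp del: min_le_iff_disj)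
        finally show "norm (LINT x|lborel. norm (case (z, x) of (z, x) \<Rightarrow> u x * second_diff \<psi> z x))
            \<le> norm (C * K * min ((norm z)\<^sup>2) 1)"
          by (simp add: mult.assoc)
      qed
    qed measurable
    show "AE z in \<nu>. integrable lborel (\<lambda>x. case (z, x) of (z, x) \<Rightarrow> u x * second_diff \<psi> z x)"
      using int by simp
  qed
  then have "(LINT x|lborel. LINT z|\<nu>. u x * second_diff \<psi> z x) = (LINT z|\<nu>. LINT x|lborel. u x * second_diff \<psi> z x)"
    by (rule lborel_nu.Fubini_integral)
  then show ?thesis
    by (simp add: levy_op_eq_second_diff[OF \<psi>] mult.left_commute[of _ "1 / 2"])
qed

text \<open>Off the support and the origin, every point is the centre of a ball that is null once
  the origin is removed; by Lindelof countably many of these balls suffice.\<close>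

lemma AE_supp: "AE z in \<nu>. z \<in> supp \<nu>"
proof -
  define \<U> where "\<U> = {ball z r | z r. emeasure \<nu> (ball z r - {0}) = 0}"
  obtain \<U>' where \<U>': "\<U>' \<subseteq> \<U>" "countable \<U>'" "\<Union>\<U>' = \<Union>\<U>"
    by (rule Lindelof[of \<U>]) (auto simp: \<U>_def)
  have "(\<Union>U\<in>\<U>'. U - {0}) \<in> null_sets \<nu>"
    using \<U>' by (intro null_sets_UN') (auto simp: \<U>_def null_sets_def sets_eq_borel)
  moreover have "{0} \<in> null_sets \<nu>"
    using null_zero by (auto simp: null_sets_def sets_eq_borel)
  ultimately have "{0} \<union> (\<Union>U\<in>\<U>'. U - {0}) \<in> null_sets \<nu>"
    by (rule null_sets.Un[rotated])
  moreover have "{z \<in> space \<nu>. z \<notin> supp \<nu>} \<subseteq> {0} \<union> (\<Union>U\<in>\<U>'. U - {0})"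
  proof
    fix z assume "z \<in> {z \<in> space \<nu>. z \<notin> supp \<nu>}"
    then consider "z = 0" | r where "z \<noteq> 0" "r > 0" "emeasure \<nu> (ball z r - {0}) = 0"
      by (auto simp: supp_def zero_less_iff_neq_zero)
    then show "z \<in> {0} \<union> (\<Union>U\<in>\<U>'. U - {0})"
    proof cases
      case 2
      then have "z \<in> \<Union>\<U>"
        unfolding \<U>_def by (force intro: centre_in_ball[THEN iffD2])
      then show ?thesis
        using 2 \<U>'(3) by blast
    qed simp
  qed
  ultimately show ?thesis
    by (rule AE_I')
qed

lemma uminus_supp:
  assumes "z \<in> supp \<nu>"
  shows "- z \<in> supp \<nu>"
proof -
  have "emeasure \<nu> (ball (- z) r - {0}) = emeasure \<nu> (ball z r - {0})" for r
  proof -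
    have "emeasure \<nu> (ball (- z) r - {0}) = emeasure (distr \<nu> borel uminus) (ball (- z) r - {0})"
      by (simp add: symmetric)
    also have "\<dots> = emeasure \<nu> (uminus -` (ball (- z) r - {0}) \<inter> space \<nu>)"
      by (intro emeasure_distr) auto
    also have "uminus -` (ball (- z) r - {0}) \<inter> space \<nu> = ball z r - {0}"
      by (auto simp: dist_norm) (metis minus_diff_eq minus_diff_commute norm_minus_cancel norm_minus_commute diff_minus_eq_add add.commute)+
    finally show ?thesis .
  qed
  with assms show ?thesis
    by (simp add: supp_def)
qed

text \<open>For \<open>z\<close> in the support, periodicity lets \<open>u\<close> move along with
  each translate of \<open>\<psi>\<close>, so the three integrals in the pairing are 1, 1 and -2
  times the same number. The support has full measure, so the outer integral vanishes.\<close>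

lemma periodic_imp_pairing_zero:
  assumes [measurable]: "u \<in> borel_measurable borel" and u: "\<And>x. \<bar>u x\<bar> \<le> C"
    and per: "\<And>z x. z \<in> supp \<nu> \<Longrightarrow> u (x + z) = u x" and \<psi>: "test_function \<psi>"
  shows "(LINT x|lborel. u x * levy_op \<nu> \<psi> x) = 0"
proof -
  have [measurable]: "\<psi> \<in> borel_measurable borel"
    using \<psi> by measurable
  have int: "integrable lborel (\<lambda>x. u x * \<psi> x)"
    by (rule Bochner_Integration.integrable_bound[OF integrable_mult_right[OF test_function_integrable[OF \<psi>], of C]])
      (use u in \<open>auto simp: abs_mult intro!: mult_right_mono order_trans[OF u abs_ge_self]\<close>)
  have "(LINT x|lborel. u x * second_diff \<psi> z x) = 0" if z: "z \<in> supp \<nu>" for z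
  proof -
    have per': "u (z + x) = u x" "u (- z + x) = u x" for x
      using per[OF z, of x] per[OF uminus_supp[OF z], of x] by (simp_all add: add.commute)
    define g where "g x = u x * \<psi> x" for x
    have [measurable]: "g \<in> borel_measurable borel"
      unfolding g_def[abs_def] by measurable
    have "(LINT x|lborel. u x * second_diff \<psi> z x) = (LINT x|lborel. g (z + x) + g (- z + x) - 2 * g x)"
      by (rule Bochner_Integration.integral_cong)
        (simp_all only: g_def per' second_diff_def, simp_all add: algebra_simps)
    also have "\<dots> = 0"
      using int lborel_integrable_shift[of g z] lborel_integrable_shift[of g "- z"]
        lborel_integral_shift[of g z] lborel_integral_shift[of g "- z"]
      by (simp add: g_def[symmetric, abs_def])
    finally show ?thesis .
  qed
  then have "AE z in \<nu>. (LINT x|lborel. u x * second_diff \<psi> z x) = 0"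
    by (rule eventually_mono[OF AE_supp])
  then have "(LINT z|\<nu>. LINT x|lborel. u x * second_diff \<psi> z x) = 0"
    by (rule integral_eq_zero_AE)
  then show ?thesis
    using pairing_levy_op[OF \<psi> assms(1) u] by simp
qed

section \<open>A Liouville theorem for bounded pointwise solutions\<close>

text \<open>
  Pointwise solutions, with exactly the regularity gained by pairing a bounded weak solution with
  the translates of a test function.
\<close>

definition levy_classical :: "('a \<Rightarrow> real) \<Rightarrow> bool" where
  "levy_classical U \<longleftrightarrow>
     (\<exists>L. \<forall>x h. norm h \<le> 1 \<longrightarrow> \<bar>U (x + h) - U x\<bar> \<le> L * norm h) \<and>
     (\<exists>K. \<forall>z x. \<bar>second_diff U z x\<bar> \<le> K * min ((norm z)\<^sup>2) 1) \<and>
     (\<forall>x. (LINT z|\<nu>. second_diff U z x) = 0)"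

lemma levy_classical_continuous: "levy_classical U \<Longrightarrow> continuous_on UNIV U"
  unfolding levy_classical_def using locally_lipschitz_continuous by metis

lemma levy_classical_integrable:
  assumes "levy_classical U"
  shows "integrable \<nu> (\<lambda>z. second_diff U z x)"
proof -
  have [measurable]: "U \<in> borel_measurable borel"
    using levy_classical_continuous[OF assms] by (rule borel_measurable_continuous_onI)
  obtain K where K: "\<And>z x. \<bar>second_diff U z x\<bar> \<le> K * min ((norm z)\<^sup>2) 1"
    using assms unfolding levy_classical_def by blast
  show ?thesis
    by (rule Bochner_Integration.integrable_bound[OF integrable_mult_right[OF integrable_min, of K]])
      (use K in \<open>auto intro!: AE_I2 order_trans[OF K abs_ge_self] simp del: abs_mult\<close>)
qed

lemma levy_classical_translate:
  assumes "levy_classical U"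
  shows "levy_classical (\<lambda>x. U (x + a))"
proof -
  have *: "second_diff (\<lambda>x. U (x + a)) z x = second_diff U z (x + a)" for z x
    by (simp add: second_diff_def algebra_simps)
  have "U (x + h + a) - U (x + a) = U ((x + a) + h) - U (x + a)" for x h
    by (simp add: algebra_simps)
  with assms show ?thesis
    unfolding levy_classical_def * by metis
qed

lemma levy_classical_minus:
  assumes "levy_classical U" "levy_classical V"
  shows "levy_classical (\<lambda>x. U x - V x)"
proof -
  have "\<exists>L. \<forall>x h. norm h \<le> 1 \<longrightarrow> \<bar>(U (x + h) - V (x + h)) - (U x - V x)\<bar> \<le> L * norm h"
  proof -
    obtain L1 L2 where "\<And>x h. norm h \<le> 1 \<Longrightarrow> \<bar>U (x + h) - U x\<bar> \<le> L1 * norm h"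
      "\<And>x h. norm h \<le> 1 \<Longrightarrow> \<bar>V (x + h) - V x\<bar> \<le> L2 * norm h"
      using assms unfolding levy_classical_def by metis
    then have "norm h \<le> 1 \<longrightarrow> \<bar>(U (x + h) - U x) - (V (x + h) - V x)\<bar> \<le> (L1 + L2) * norm h" for x h
      unfolding distrib_right by (intro impI, rule_tac order_trans[OF abs_triangle_ineq4]) (intro add_mono)
    moreover have "(U (x + h) - V (x + h)) - (U x - V x) = (U (x + h) - U x) - (V (x + h) - V x)" for x h
      by simp
    ultimately show ?thesis
      by metis
  qed
  moreover have *: "second_diff (\<lambda>x. U x - V x) z x = second_diff U z x - second_diff V z x" for z x
    by (simp add: second_diff_def)
  moreover have "\<exists>K. \<forall>z x. \<bar>second_diff (\<lambda>x. U x - V x) z x\<bar> \<le> K * min ((norm z)\<^sup>2) 1"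
  proof -
    obtain K1 K2 where "\<And>z x. \<bar>second_diff U z x\<bar> \<le> K1 * min ((norm z)\<^sup>2) 1"
      "\<And>z x. \<bar>second_diff V z x\<bar> \<le> K2 * min ((norm z)\<^sup>2) 1"
      using assms unfolding levy_classical_def by metis
    then have "\<bar>second_diff U z x - second_diff V z x\<bar> \<le> (K1 + K2) * min ((norm z)\<^sup>2) 1" for z x
      unfolding distrib_right by (intro order_trans[OF abs_triangle_ineq4] add_mono)
    then show ?thesis
      unfolding * by blast
  qed
  moreover have "(LINT z|\<nu>. second_diff (\<lambda>x. U x - V x) z x) = 0" for x
    using assms levy_classical_integrable unfolding * levy_classical_def by simp
  ultimately show ?thesis
    unfolding levy_classical_def by blast
qed

lemma levy_classical_const: "levy_classical (\<lambda>_. c)"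
  unfolding levy_classical_def second_diff_def by (auto intro!: exI[of _ 0])

text \<open>Approximate strong minimum principle. Where \<open>w\<close> is nearly 0 its second
  differences are nearly nonnegative, and since their integral vanishes the positive contributions
  must be small too. Small balls around \<open>z\<close> have positive measure and \<open>w\<close>
  varies little on them, so \<open>w (x n + z)\<close> is small.\<close>

lemma zero_minimum_propagates:
  assumes w: "levy_classical w" and pos: "\<And>x. w x \<ge> 0" and lim: "(\<lambda>n. w (x n)) \<longlonglongrightarrow> 0"
    and z: "z \<in> supp \<nu>"
  shows "(\<lambda>n. w (x n + z)) \<longlonglongrightarrow> 0"
proof -
  have [measurable]: "w \<in> borel_measurable borel"
    using levy_classical_continuous[OF w] by (rule borel_measurable_continuous_onI)
  obtain L where L: "\<And>x h. norm h \<le> 1 \<Longrightarrow> \<bar>w (x + h) - w x\<bar> \<le> L * norm h"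
    using w unfolding levy_classical_def by blast
  obtain K where K: "\<And>z x. \<bar>second_diff w z x\<bar> \<le> K * min ((norm z)\<^sup>2) 1"
    using w unfolding levy_classical_def by blast
  \<comment> \<open>Both terms bound the negative part of the second difference at
    \<open>x n\<close>: the first, valid since \<open>w\<close> is nonnegative, forces
    \<open>m n\<close> to 0, and the second supplies an integrable majorant.\<close>
  define m where "m n y = min (2 * w (x n)) (K * min ((norm y)\<^sup>2) 1)" for n and y :: 'a
  define \<epsilon> where "\<epsilon> n = (LINT y|\<nu>. m n y)" for n
  have Km: "K * min ((norm y)\<^sup>2) 1 \<ge> 0" for y :: 'a
    using K[of y 0] by linarith
  have m_pos: "m n y \<ge> 0" and m_le: "m n y \<le> K * min ((norm y)\<^sup>2) 1" for n y
    unfolding m_def using pos[of "x n"] Km[of y] by auto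
  have m_int: "integrable \<nu> (m n)" for n
    by (rule Bochner_Integration.integrable_bound[OF integrable_mult_right[OF integrable_min, of K]])
      (use m_pos m_le Km in \<open>auto simp: m_def[abs_def] simp del: min_less_iff_conj min_le_iff_disj\<close>)
  have \<epsilon>: "\<epsilon> \<longlonglongrightarrow> 0"
  proof -
    have "(\<lambda>n. LINT y|\<nu>. m n y) \<longlonglongrightarrow> (LINT y|\<nu>. 0)"
    proof (rule integral_dominated_convergence[where w = "\<lambda>y. K * min ((norm y)\<^sup>2) 1"])
      show "AE y in \<nu>. (\<lambda>n. m n y) \<longlonglongrightarrow> 0"
      proof (rule AE_I2)
        fix y :: 'a
        have "(\<lambda>n. m n y) \<longlonglongrightarrow> min (2 * 0) (K * min ((norm y)\<^sup>2) 1)"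
          unfolding m_def by (intro tendsto_intros lim)
        then show "(\<lambda>n. m n y) \<longlonglongrightarrow> 0"
          using Km[of y] by simp
      qed
      show "AE y in \<nu>. norm (m n y) \<le> K * min ((norm y)\<^sup>2) 1" for n
        using m_pos m_le by simp
    qed (use integrable_min in \<open>auto simp: m_def[abs_def]\<close>)
    then show ?thesis
      by (simp add: \<epsilon>_def[abs_def])
  qed
  have bound: "\<exists>c>0. \<forall>n. w (x n + z) \<le> \<epsilon> n / c + L * \<rho> + 2 * w (x n)"
    if \<rho>: "0 < \<rho>" "\<rho> \<le> 1" "\<rho> \<le> norm z / 2" for \<rho>
  proof -
    define c where "c = measure \<nu> (ball z \<rho>)"
    have sub: "ball z \<rho> \<subseteq> {y. norm y > norm z / 2}"
    proof
      fix y assume "y \<in> ball z \<rho>"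
      then show "y \<in> {y. norm y > norm z / 2}"
        using \<rho>(3) norm_triangle_sub[of z y] by (simp add: dist_norm)
    qed
    have "norm z / 2 > 0"
      using z by (simp add: supp_def)
    then have fin: "emeasure \<nu> (ball z \<rho>) < \<infinity>"
      using emeasure_mono[OF sub, of \<nu>] emeasure_outside_ball_finite[of "norm z / 2"]
      by (auto simp: sets_eq_borel intro: le_less_trans)
    have "ball z \<rho> - {0} = ball z \<rho>"
      using sub by fastforce
    then have "emeasure \<nu> (ball z \<rho>) > 0"
      using z \<rho>(1) unfolding supp_def by fastforce
    then have "c > 0"
      using fin by (simp add: c_def measure_def enn2real_positive_iff)
    moreover have "w (x n + z) \<le> \<epsilon> n / c + L * \<rho> + 2 * w (x n)" for n
    proof -
      \<comment> \<open>A lower bound for the second difference on the whole ball: drop the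
        nonnegative \<open>w (x n - y)\<close> and compare \<open>w (x n + y)\<close> with
        \<open>w (x n + z)\<close> by the Lipschitz estimate.\<close>
      define a where "a = w (x n + z) - L * \<rho> - 2 * w (x n)"
      have "a * c = (LINT y|\<nu>. a * indicator (ball z \<rho>) y)"
        by (simp add: c_def)
      also have "\<dots> \<le> (LINT y|\<nu>. second_diff w y (x n) + m n y)"
      proof (rule integral_mono)
        show "integrable \<nu> (\<lambda>y. a * indicator (ball z \<rho>) y)"
          using fin by (intro integrable_mult_right) (simp add: integrable_indicator_iff sets_eq_borel)
        show "integrable \<nu> (\<lambda>y. second_diff w y (x n) + m n y)"
          by (intro Bochner_Integration.integrable_add levy_classical_integrable w m_int)
        fix y
        show "a * indicator (ball z \<rho>) y \<le> second_diff w y (x n) + m n y"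
        proof (cases "y \<in> ball z \<rho>")
          case True
          then have "norm (z - y) \<le> \<rho>"
            by (simp add: dist_norm)
          moreover have "L \<ge> 0"
            using L[of "(1 / norm z) *\<^sub>R z" 0] \<open>norm z / 2 > 0\<close> by simp
          ultimately have "\<bar>w ((x n + y) + (z - y)) - w (x n + y)\<bar> \<le> L * \<rho>"
            using L[of "z - y" "x n + y"] \<rho>(2) by (meson mult_left_mono order_trans)
          then show ?thesis
            using True pos[of "x n - y"] m_pos[of n y] by (simp add: a_def second_diff_def)
        next
          case False
          then show ?thesis
            using pos[of "x n - y"] pos[of "x n + y"] K[of y "x n"] unfolding m_def second_diff_def by auto
        qed
      qed
      also have "\<dots> = \<epsilon> n"
        using w levy_classical_integrable[OF w] m_int by (simp add: \<epsilon>_def levy_classical_def)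
      finally have "a \<le> \<epsilon> n / c"
        using \<open>c > 0\<close> by (simp add: pos_le_divide_eq)
      then show ?thesis
        by (simp add: a_def)
    qed
    ultimately show ?thesis
      by blast
  qed
  show ?thesis
  proof (rule LIMSEQ_I)
    fix e :: real assume "e > 0"
    \<comment> \<open>The radius is chosen so that the Lipschitz error \<open>L * \<rho>\<close>
      uses at most half of \<open>e\<close>; the other error terms tend to 0 once the radius is
      fixed.\<close>
    define \<rho> where "\<rho> = min (min 1 (norm z / 2)) (e / (2 * (\<bar>L\<bar> + 1)))"
    have \<rho>_le: "\<rho> \<le> 1" "\<rho> \<le> norm z / 2" "\<rho> \<le> e / (2 * (\<bar>L\<bar> + 1))"
      unfolding \<rho>_def by linarith+
    have "\<rho> > 0"
      using \<open>e > 0\<close> z by (auto simp: \<rho>_def supp_def)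
    note \<rho> = this \<rho>_le
    have "L * \<rho> \<le> (\<bar>L\<bar> + 1) * (e / (2 * (\<bar>L\<bar> + 1)))"
      using \<rho> \<open>e > 0\<close> by (intro mult_mono) auto
    also have "\<dots> = e / 2"
    proof -
      have "\<bar>L\<bar> + 1 \<noteq> 0"
        by linarith
      then show ?thesis
        by (simp add: divide_simps)
    qed
    finally have L\<rho>: "L * \<rho> \<le> e / 2" .
    obtain c where c: "c > 0" "\<And>n. w (x n + z) \<le> \<epsilon> n / c + L * \<rho> + 2 * w (x n)"
      using bound[OF \<rho>(1-3)] by blast
    have "(\<lambda>n. \<epsilon> n / c + 2 * w (x n)) \<longlonglongrightarrow> 0 / c + 2 * 0"
      using c(1) by (intro tendsto_intros \<epsilon> lim) auto
    then have "\<forall>\<^sub>F n in sequentially. \<epsilon> n / c + 2 * w (x n) < e / 2"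
      by (rule order_tendstoD) (use \<open>e > 0\<close> in simp)
    then have "\<forall>\<^sub>F n in sequentially. norm (w (x n + z) - 0) < e"
    proof eventually_elim
      case (elim n)
      then show ?case
        using c(2)[of n] L\<rho> pos[of "x n + z"] by (simp only: real_norm_def diff_0_right abs_of_nonneg)
    qed
    then show "\<exists>N. \<forall>n\<ge>N. norm (w (x n + z) - 0) < e"
      by (simp add: eventually_sequentially)
  qed
qed

text \<open>
  If the supremum \<open>S\<close> of \<open>U (x + z) - U x\<close> is approached along \<open>y n\<close>, it is also approached
  along each \<open>y n + k z\<close>, and telescoping gives \<open>k S \<le> 2 C\<close> for all \<open>k\<close>.
\<close>

lemma levy_classical_le_translate:
  assumes U: "levy_classical U" and C: "\<And>x. \<bar>U x\<bar> \<le> C" and z: "z \<in> supp \<nu>"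
  shows "U (x + z) \<le> U x"
proof -
  define V where "V x = U (x + z) - U x" for x
  define S where "S = (SUP x. V x)"
  have "V x \<le> 2 * C" for x
    using C[of "x + z"] C[of x] by (simp add: V_def)
  then have bdd: "bdd_above (range V)"
    by (rule bdd_aboveI2)
  then have le: "V x \<le> S" for x
    unfolding S_def by (rule cSUP_upper[OF UNIV_I])
  \<comment> \<open>The gap to the supremum: a nonnegative solution with infimum 0, to which the
    minimum principle applies.\<close>
  define w where "w x = S - V x" for x
  have w: "levy_classical w"
    unfolding w_def[abs_def] V_def by (intro levy_classical_minus levy_classical_const levy_classical_translate U)
  have pos: "w x \<ge> 0" for x
    using le by (simp add: w_def)
  have "\<exists>y. w y < 1 / real (Suc n)" for n
  proof -
    have "S - 1 / real (Suc n) < S"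
      by simp
    then obtain y where "S - 1 / real (Suc n) < V y"
      unfolding S_def using less_cSUP_iff[OF _ bdd] by auto
    then show ?thesis
      by (intro exI[of _ y]) (simp add: w_def)
  qed
  then obtain y where y: "\<And>n. w (y n) < 1 / real (Suc n)"
    by metis
  have lim0: "(\<lambda>n. w (y n)) \<longlonglongrightarrow> 0"
    by (rule tendsto_sandwich[OF _ _ tendsto_const lim_inverse_n'[THEN LIMSEQ_Suc]])
      (use pos y in \<open>auto intro!: always_eventually less_imp_le\<close>)
  have lim: "(\<lambda>n. w (y n + real k *\<^sub>R z)) \<longlonglongrightarrow> 0" for k
  proof (induction k)
    case (Suc k)
    then show ?case
      using zero_minimum_propagates[OF w pos Suc z] by (simp add: algebra_simps)
  qed (use lim0 in simp)
  have "real k * S \<le> 2 * C" for k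
  proof -
    have "(\<lambda>n. \<Sum>j<k. S - w (y n + real j *\<^sub>R z)) \<longlonglongrightarrow> (\<Sum>j<k. S - 0)"
      by (intro tendsto_intros lim)
    moreover have "(\<Sum>j<k. S - w (y n + real j *\<^sub>R z)) = U (y n + real k *\<^sub>R z) - U (y n)" for n
      by (induction k) (simp_all add: w_def V_def algebra_simps)
    moreover have "U (y n + real k *\<^sub>R z) - U (y n) \<le> 2 * C" for n
      using C[of "y n + real k *\<^sub>R z"] C[of "y n"] by simp
    ultimately show ?thesis
      by (intro LIMSEQ_le_const2[of "\<lambda>n. U (y n + real k *\<^sub>R z) - U (y n)"]) auto
  qed
  then have "S \<le> 0"
    using reals_Archimedean3[of S] by (meson not_le)
  then show ?thesis
    using le[of x] by (simp add: V_def)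
qed

text \<open>The one-sided inequality, used for \<open>z\<close> and for \<open>- z\<close>, makes
  every point of the support a period. Periods form a group, and continuity carries the constancy
  from the dense group to the whole space.\<close>

lemma levy_classical_liouville:
  assumes U: "levy_classical U" and C: "\<And>x. \<bar>U x\<bar> \<le> C"
    and dense: "closure (group_closure (supp \<nu>)) = UNIV"
  shows "U x = U 0"
proof -
  have supp: "U (x + z) = U x" if "z \<in> supp \<nu>" for x z
    using levy_classical_le_translate[OF U C that, of x]
      levy_classical_le_translate[OF U C uminus_supp[OF that], of "x + z"] by simp
  have group: "\<forall>x. U (x + p) = U x" if "p \<in> group_closure (supp \<nu>)" for p
    using that
  proof induction
    case (base s)
    then show ?case
      using supp by auto
  next
    case (diff s t)
    then show ?case
      by (metis diff_add_cancel add.commute add_diff_eq)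
  qed
  have "closed {p. U p = U 0}"
    using levy_classical_continuous[OF U] by (intro closed_Collect_eq) auto
  moreover have "group_closure (supp \<nu>) \<subseteq> {p. U p = U 0}"
    using group[of _] by (metis (mono_tags, lifting) add.left_neutral mem_Collect_eq subsetI)
  ultimately have "closure (group_closure (supp \<nu>)) \<subseteq> {p. U p = U 0}"
    by (rule closure_minimal[rotated])
  with dense show ?thesis
    by auto
qed

text \<open>Differences in \<open>x\<close> move from the pairing onto \<open>\<phi>\<close>, and
  since \<open>u\<close> is bounded the L1 estimates for \<open>\<phi>\<close> become uniform
  estimates. Integrating the second differences over \<open>\<nu>\<close> returns the weak equation
  tested with a translate of \<open>\<phi>\<close>.\<close>

lemma pairing_translates_levy_classical:
  assumes \<phi>: "test_function \<phi>" and [measurable]: "u \<in> borel_measurable borel"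
    and u: "\<And>x. \<bar>u x\<bar> \<le> C"
    and harm: "\<And>\<psi>. test_function \<psi> \<Longrightarrow> (LINT x|lborel. u x * levy_op \<nu> \<psi> x) = 0"
  shows "levy_classical (\<lambda>x. LINT y|lborel. u y * \<phi> (x + y))"
    and "\<exists>B. \<forall>x. \<bar>LINT y|lborel. u y * \<phi> (x + y)\<bar> \<le> B"
proof -
  define U where "U x = (LINT y|lborel. u y * \<phi> (x + y))" for x
  have "C \<ge> 0"
    using u[of 0] by linarith
  have [measurable]: "\<phi> \<in> borel_measurable borel"
    using \<phi> by measurable
  have u_int: "integrable lborel (\<lambda>y. u y * f y)"
    and u_bound: "\<bar>LINT y|lborel. u y * f y\<bar> \<le> C * (LINT y|lborel. \<bar>f y\<bar>)"
    if f: "integrable lborel f" for f :: "'a \<Rightarrow> real"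
  proof -
    have [measurable]: "f \<in> borel_measurable borel"
      using f by auto
    have le: "\<bar>u y * f y\<bar> \<le> C * \<bar>f y\<bar>" for y
      using u by (auto simp: abs_mult intro!: mult_right_mono)
    show int: "integrable lborel (\<lambda>y. u y * f y)"
      by (rule Bochner_Integration.integrable_bound[OF integrable_mult_right[OF integrable_abs[OF f], of C]])
        (use le \<open>C \<ge> 0\<close> in \<open>auto simp: abs_mult\<close>)
    have "\<bar>LINT y|lborel. u y * f y\<bar> \<le> (LINT y|lborel. \<bar>u y * f y\<bar>)"
      by (rule integral_abs_bound)
    also have "\<dots> \<le> (LINT y|lborel. C * \<bar>f y\<bar>)"
      using int f le by (intro integral_mono) auto
    finally show "\<bar>LINT y|lborel. u y * f y\<bar> \<le> C * (LINT y|lborel. \<bar>f y\<bar>)"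
      by simp
  qed
  note shift = test_function_shift[OF \<phi>]
  note int = test_function_integrable[OF shift]
  obtain L where L: "L \<ge> 0" "\<And>h. norm h \<le> 1 \<Longrightarrow> (LINT y|lborel. \<bar>\<phi> (y + h) - \<phi> y\<bar>) \<le> L * norm h"
    using first_diff_L1_bound[OF \<phi>] by metis
  have lip: "\<bar>U (x + h) - U x\<bar> \<le> (C * L) * norm h" if "norm h \<le> 1" for x h
  proof -
    have "U (x + h) - U x = (LINT y|lborel. u y * (\<phi> (x + h + y) - \<phi> (x + y)))"
      using u_int[OF int] by (simp add: U_def right_diff_distrib)
    also have "\<bar>\<dots>\<bar> \<le> C * (LINT y|lborel. \<bar>\<phi> (x + h + y) - \<phi> (x + y)\<bar>)"
      using int by (intro u_bound) auto
    also have "(LINT y|lborel. \<bar>\<phi> (x + h + y) - \<phi> (x + y)\<bar>) = (LINT y|lborel. \<bar>\<phi> (y + h) - \<phi> y\<bar>)"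
      using lborel_integral_shift[of "\<lambda>y. \<bar>\<phi> (y + h) - \<phi> y\<bar>" x] by (simp add: add_ac)
    finally show ?thesis
      using mult_left_mono[OF L(2)[OF that] \<open>C \<ge> 0\<close>] by (simp add: mult.assoc)
  qed
  have sd: "second_diff U z x = (LINT y|lborel. u y * second_diff (\<lambda>y. \<phi> (x + y)) z y)" for z x
  proof -
    have "second_diff U z x = (LINT y|lborel. u y * \<phi> (x + z + y) + u y * \<phi> (x - z + y) - 2 * (u y * \<phi> (x + y)))"
      using u_int[OF int] u_int[OF int[of "x - z"]] by (simp add: U_def second_diff_def)
    then show ?thesis
      by (simp add: second_diff_def algebra_simps)
  qed
  obtain K where K: "K \<ge> 0" "\<And>z. (LINT y|lborel. \<bar>second_diff \<phi> z y\<bar>) \<le> K * min ((norm z)\<^sup>2) 1"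
    using second_diff_L1_bound[OF \<phi>] by metis
  have "\<bar>second_diff U z x\<bar> \<le> (C * K) * min ((norm z)\<^sup>2) 1" for z x
  proof -
    have "\<bar>second_diff U z x\<bar> \<le> C * (LINT y|lborel. \<bar>second_diff (\<lambda>y. \<phi> (x + y)) z y\<bar>)"
      unfolding sd by (intro u_bound second_diff_integrable shift)
    also have "(LINT y|lborel. \<bar>second_diff (\<lambda>y. \<phi> (x + y)) z y\<bar>) = (LINT y|lborel. \<bar>second_diff \<phi> z y\<bar>)"
      using lborel_integral_shift[of "\<lambda>y. \<bar>second_diff \<phi> z y\<bar>" x] by (simp add: second_diff_def add_ac add_diff_eq)
    finally show ?thesis
      using mult_left_mono[OF K(2)[of z] \<open>C \<ge> 0\<close>] by (simp add: mult.assoc)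
  qed
  moreover have "(LINT z|\<nu>. second_diff U z x) = 0" for x
    using harm[OF shift] pairing_levy_op[OF shift[of x] assms(2) u] by (simp add: sd)
  ultimately show "levy_classical (\<lambda>x. LINT y|lborel. u y * \<phi> (x + y))"
    using lip unfolding levy_classical_def U_def[symmetric] by blast
  have "\<bar>U x\<bar> \<le> C * (LINT y|lborel. \<bar>\<phi> y\<bar>)" for x
    using u_bound[OF int[of x]] lborel_integral_shift[of "\<lambda>y. \<bar>\<phi> y\<bar>" x] by (simp add: U_def)
  then show "\<exists>B. \<forall>x. \<bar>LINT y|lborel. u y * \<phi> (x + y)\<bar> \<le> B"
    unfolding U_def by blast
qed

lemma pairing_translation_invariant:
  assumes "test_function \<phi>" and "u \<in> borel_measurable borel" and "\<And>x. \<bar>u x\<bar> \<le> C"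
    and "\<And>\<psi>. test_function \<psi> \<Longrightarrow> (LINT x|lborel. u x * levy_op \<nu> \<psi> x) = 0"
    and "closure (group_closure (supp \<nu>)) = UNIV"
  shows "(LINT y|lborel. u y * \<phi> (x + y)) = (LINT y|lborel. u y * \<phi> y)"
proof -
  note classical = pairing_translates_levy_classical[OF assms(1-4)]
  then obtain B where "\<And>x. \<bar>LINT y|lborel. u y * \<phi> (x + y)\<bar> \<le> B"
    by blast
  from levy_classical_liouville[OF classical(1) this assms(5)] show ?thesis
    by simp
qed

lemma levy_op_measurable:
  assumes \<psi>: "test_function \<psi>"
  shows "levy_op \<nu> \<psi> \<in> borel_measurable borel"
proof -
  have [measurable]: "\<psi> \<in> borel_measurable borel"
    using \<psi> by measurable
  have "(\<lambda>x. 1 / 2 * (LINT z|\<nu>. second_diff \<psi> z x)) \<in> borel_measurable borel"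
    unfolding second_diff_def by measurable
  then show ?thesis
    by (simp add: levy_op_eq_second_diff[OF \<psi>, abs_def])
qed

end

section \<open>Translation invariant pairings and the Liouville property\<close>

lemma integrable_indicator_box:
  "integrable lborel (indicator (box l r) :: 'a::euclidean_space \<Rightarrow> real)"
  by (intro integrable_real_indicator) (auto simp: emeasure_lborel_box_finite simp flip: infinity_ennreal_def)

text \<open>Adding a small multiple of \<open>g\<close> to the density of Lebesgue measure keeps it
  nonnegative and preserves the volume of all boxes; by uniqueness the result is Lebesgue measure,
  so the new density is 1 almost everywhere.\<close>

lemma AE_zero_if_box_integrals_zero:
  fixes g :: "'a::euclidean_space \<Rightarrow> real"
  assumes [measurable]: "g \<in> borel_measurable borel" and K: "\<And>x. \<bar>g x\<bar> \<le> K"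
    and zero: "\<And>l r. (LINT x|lborel. g x * indicator (box l r) x) = 0"
  shows "AE x in lborel. g x = 0"
proof -
  have "K \<ge> 0"
    using K[of 0] by linarith
  \<comment> \<open>Dividing by \<open>K + 1\<close> keeps the density nonnegative and avoids
    division by zero when \<open>K = 0\<close>.\<close>
  define h where "h x = 1 + g x / (K + 1)" for x
  have h: "h x \<ge> 0" for x
  proof -
    have "- (K + 1) \<le> g x"
      using K[of x] by linarith
    then have "- 1 \<le> g x / (K + 1)"
      using \<open>K \<ge> 0\<close> by (simp add: pos_le_divide_eq)
    then show ?thesis
      by (simp add: h_def)
  qed
  have [measurable]: "h \<in> borel_measurable borel"
    unfolding h_def[abs_def] by measurable
  have "lborel = density lborel (\<lambda>x. ennreal (h x))"
  proof (rule lborel_eqI)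
    fix l r :: 'a
    assume lr: "\<And>b. b \<in> Basis \<Longrightarrow> l \<bullet> b \<le> r \<bullet> b"
    note ind = integrable_indicator_box[of l r]
    have int: "integrable lborel (\<lambda>x. g x * indicator (box l r) x)"
      by (rule Bochner_Integration.integrable_bound[OF integrable_mult_right[OF ind, of K]])
        (use K \<open>K \<ge> 0\<close> in \<open>auto simp: indicator_def\<close>)
    have eq: "h x * indicator (box l r) x = indicator (box l r) x + (g x * indicator (box l r) x) / (K + 1)" for x
      by (simp add: h_def algebra_simps)
    have "emeasure (density lborel (\<lambda>x. ennreal (h x))) (box l r)
        = (\<integral>\<^sup>+x. ennreal (h x * indicator (box l r) x) \<partial>lborel)"
      by (subst emeasure_density) (auto intro!: nn_integral_cong simp: indicator_def)
    also have "\<dots> = ennreal (LINT x|lborel. h x * indicator (box l r) x)"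
    proof (rule nn_integral_eq_integral)
      show "integrable lborel (\<lambda>x. h x * indicator (box l r) x)"
        using ind int by (simp add: eq)
    qed (use h in \<open>auto simp: indicator_def\<close>)
    also have "(LINT x|lborel. h x * indicator (box l r) x) = measure lborel (box l r)"
      using ind int zero[of l r] by (simp add: eq)
    also have "ennreal \<dots> = emeasure lborel (box l r)"
      using emeasure_lborel_box_finite[of l r] by (intro emeasure_eq_ennreal_measure[symmetric]) auto
    also have "\<dots> = (\<Prod>b\<in>Basis. (r - l) \<bullet> b)"
      using lr by (rule emeasure_lborel_box)
    finally show "emeasure (density lborel (\<lambda>x. ennreal (h x))) (box l r) = (\<Prod>b\<in>Basis. (r - l) \<bullet> b)" .
  qed simp
  then have "density lborel (\<lambda>_::'a. 1) = density lborel (\<lambda>x. ennreal (h x))"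
    by (simp add: density_1)
  then have "AE x in lborel. 1 = ennreal (h x)"
    by (intro sigma_finite_measure.density_unique[OF sigma_finite_lborel]) auto
  then show ?thesis
  proof eventually_elim
    case (elim x)
    then have "h x = 1"
      using h[of x] by (simp add: ennreal_eq_1)
    then show "g x = 0"
      using \<open>K \<ge> 0\<close> by (simp add: h_def)
  qed
qed

text \<open>Serves to extend the invariance of pairings from test functions to indicators of boxes;
  the bumps are at most 1 and vanish off the box, which gives the dominating function.\<close>

lemma box_pairing_limit:
  fixes u :: "'a::euclidean_space \<Rightarrow> real"
  assumes [measurable]: "u \<in> borel_measurable borel" and C: "\<And>x. \<bar>u x\<bar> \<le> C"
  shows "(\<lambda>n. LINT y|lborel. u y * box_bump l r n (x + y)) \<longlonglongrightarrow>
    (LINT y|lborel. u y * indicator (box l r) (x + y))"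
proof (rule integral_dominated_convergence[where w = "\<lambda>y. C * indicator (box l r) (x + y)"])
  have [measurable]: "box_bump l r n \<in> borel_measurable borel" for n
    using box_bump_test_function by measurable
  show "(\<lambda>y. u y * box_bump l r n (x + y)) \<in> borel_measurable lborel" for n
    by measurable
  show "integrable lborel (\<lambda>y. C * indicator (box l r) (x + y))"
    by (intro integrable_mult_right lborel_integrable_shift[of "indicator (box l r)"] integrable_indicator_box)
  show "AE y in lborel. (\<lambda>n. u y * box_bump l r n (x + y)) \<longlonglongrightarrow> u y * indicator (box l r) (x + y)"
    by (intro AE_I2 tendsto_intros box_bump_tendsto)
  have "\<bar>u y\<bar> * \<bar>box_bump l r n (x + y)\<bar> \<le> C * indicator (box l r) (x + y)" for y n
  proof (cases "x + y \<in> box l r")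
    case True
    have "\<bar>box_bump l r n (x + y)\<bar> \<le> 1"
      using box_bump_bounds[of l r n "x + y"] by simp
    then have "\<bar>u y\<bar> * \<bar>box_bump l r n (x + y)\<bar> \<le> C * 1"
      using C[of y] by (intro mult_mono) auto
    then show ?thesis
      using True by simp
  qed (simp add: box_bump_outside)
  then show "AE y in lborel. norm (u y * box_bump l r n (x + y)) \<le> C * indicator (box l r) (x + y)" for n
    by (simp add: abs_mult)
qed measurable

text \<open>Justifies both interchanges of integrals in the comparison of two pairings, with
  \<open>s\<close> the identity in one and the reflection in the other.\<close>

lemma integrable_shifted_indicator_product:
  fixes u :: "'a::euclidean_space \<Rightarrow> real" and A B :: "'a set"
  assumes [measurable]: "u \<in> borel_measurable borel" "A \<in> sets borel" "B \<in> sets borel" "s \<in> borel_measurable borel"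
    and C: "\<And>x. \<bar>u x\<bar> \<le> C" and fin: "emeasure lborel A < \<infinity>" "emeasure lborel B < \<infinity>"
  shows "integrable (lborel \<Otimes>\<^sub>M lborel) (\<lambda>(h, y). u y * indicator A (s h + y) * indicator B h)"
proof (rule lborel_pair.Fubini_integrable)
  have "C \<ge> 0"
    using C[of 0] by linarith
  have ind: "integrable lborel (\<lambda>y. indicator A (c + y) :: real)" for c
    using fin by (intro lborel_integrable_shift[of "indicator A"]) (simp add: integrable_indicator_iff)
  have int: "integrable lborel (\<lambda>y. u y * indicator A (c + y))" for c
    by (rule Bochner_Integration.integrable_bound[OF integrable_mult_right[OF ind, of C]])
      (use C \<open>C \<ge> 0\<close> in \<open>auto simp: indicator_def\<close>)
  show "(\<lambda>(h, y). u y * indicator A (s h + y) * indicator B h) \<in> borel_measurable (lborel \<Otimes>\<^sub>M lborel)"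
    by measurable
  show "AE h in lborel. integrable lborel (\<lambda>y. case (h, y) of (h, y) \<Rightarrow> u y * indicator A (s h + y) * indicator B h)"
    using int by auto
  have bound: "(LINT y|lborel. \<bar>u y * indicator A (c + y)\<bar>) \<le> C * measure lborel A" for c
  proof -
    have "(LINT y|lborel. \<bar>u y * indicator A (c + y)\<bar>) \<le> (LINT y|lborel. C * indicator A (c + y))"
      using C by (intro integral_mono integrable_abs int integrable_mult_right ind) (auto simp: indicator_def)
    also have "\<dots> = C * measure lborel A"
      using lborel_integral_shift[of "indicator A" c] by simp
    finally show ?thesis .
  qed
  have "integrable lborel (\<lambda>h. (C * measure lborel A) * indicator B h)"
    using fin by (intro integrable_mult_right) (simp add: integrable_indicator_iff)
  then show "integrable lborel (\<lambda>h. LINT y|lborel. norm (case (h, y) of (h, y) \<Rightarrow> u y * indicator A (s h + y) * indicator B h))"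
  proof (rule Bochner_Integration.integrable_bound)
    show "AE h in lborel. norm (LINT y|lborel. norm (case (h, y) of (h, y) \<Rightarrow> u y * indicator A (s h + y) * indicator B h))
        \<le> norm (C * measure lborel A * indicator B h)"
      using bound \<open>C \<ge> 0\<close> by (intro AE_I2) (auto simp: indicator_def)
  qed measurable
qed

text \<open>
  A translation invariant pairing is a multiple of Lebesgue measure: evaluate the double integral
  of \<open>u y\<close> over the pairs \<open>(h, y)\<close> with \<open>h + y \<in> A\<close>, \<open>h \<in> B\<close> in both orders. Symmetry of \<open>B\<close>
  avoids a reflection.
\<close>

lemma invariant_pairing_proportional:
  fixes u :: "'a::euclidean_space \<Rightarrow> real" and A B :: "'a set"
  assumes [measurable]: "u \<in> borel_measurable borel" "A \<in> sets borel" "B \<in> sets borel"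
    and C: "\<And>x. \<bar>u x\<bar> \<le> C" and fin: "emeasure lborel A < \<infinity>" "emeasure lborel B < \<infinity>"
    and A: "\<And>x. (LINT y|lborel. u y * indicator A (x + y)) = FA"
    and B: "\<And>x. (LINT y|lborel. u y * indicator B (x + y)) = FB"
    and sym: "\<And>x. - x \<in> B \<longleftrightarrow> x \<in> B"
  shows "FA * measure lborel B = FB * measure lborel A"
proof -
  have "FA * measure lborel B = (LINT h|lborel. LINT y|lborel. u y * indicator A (h + y) * indicator B h)"
    by (simp add: A mult.commute)
  also have "\<dots> = (LINT y|lborel. LINT h|lborel. u y * indicator A (h + y) * indicator B h)"
    using integrable_shifted_indicator_product[of u A B "\<lambda>h. h" C] C fin
    by (intro lborel_pair.Fubini_integral[symmetric]) simp
  \<comment> \<open>Substituting \<open>h - y\<close> for \<open>h\<close> moves \<open>y\<close>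
    from the condition on \<open>A\<close> to that on \<open>B\<close>; symmetry of \<open>B\<close>
    then turns \<open>h - y\<close> into \<open>y - h\<close>.\<close>
  also have "\<dots> = (LINT y|lborel. LINT h|lborel. u y * indicator B (- h + y) * indicator A h)"
  proof (rule Bochner_Integration.integral_cong)
    fix y
    have "indicator B (- h + y) = (indicator B (- y + h) :: real)" for h
      using sym[of "- h + y"] by (simp add: indicator_def)
    then have "(LINT h|lborel. u y * indicator B (- h + y) * indicator A h)
        = (LINT h|lborel. u y * indicator A ((- y + h) + y) * indicator B (- y + h))"
      by (simp add: mult_ac)
    also have "\<dots> = (LINT h|lborel. u y * indicator A (h + y) * indicator B h)"
      by (rule lborel_integral_shift[of "\<lambda>h. u y * indicator A (h + y) * indicator B h"]) measurable
    finally show "(LINT h|lborel. u y * indicator A (h + y) * indicator B h)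
        = (LINT h|lborel. u y * indicator B (- h + y) * indicator A h)" ..
  qed simp
  also have "\<dots> = (LINT h|lborel. LINT y|lborel. u y * indicator B (- h + y) * indicator A h)"
    using integrable_shifted_indicator_product[of u B A uminus C] C fin
    by (intro lborel_pair.Fubini_integral) simp
  also have "\<dots> = (LINT h|lborel. FB * indicator A h)"
    using B[of "- h" for h] by simp
  also have "\<dots> = FB * measure lborel A"
    by simp
  finally show ?thesis .
qed

section \<open>Density and the Liouville property\<close>

text \<open>Box integrals of \<open>u\<close> are translation invariant, hence a constant multiple
  \<open>c\<close> of volume, and \<open>u - c\<close> has all box integrals zero.\<close>

lemma (in levy_measure) dense_imp_constant:
  assumes u [measurable]: "u \<in> borel_measurable borel" and C: "\<And>x. \<bar>u x\<bar> \<le> C"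
    and harm: "\<And>\<psi>. test_function \<psi> \<Longrightarrow> (LINT x|lborel. u x * levy_op \<nu> \<psi> x) = 0"
    and dense: "closure (group_closure (supp \<nu>)) = UNIV"
  shows "\<exists>c. AE x in lborel. u x = c"
proof -
  define F where "F l r = (LINT y|lborel. u y * indicator (box l r) y)" for l r :: 'a
  have F: "(LINT y|lborel. u y * indicator (box l r) (x + y)) = F l r" for l r x
  proof (rule LIMSEQ_unique)
    show "(\<lambda>n. LINT y|lborel. u y * box_bump l r n (x + y)) \<longlonglongrightarrow>
        (LINT y|lborel. u y * indicator (box l r) (x + y))"
      by (rule box_pairing_limit[OF u C])
    have "(\<lambda>n. LINT y|lborel. u y * box_bump l r n (0 + y)) \<longlonglongrightarrow>
        (LINT y|lborel. u y * indicator (box l r) (0 + y))"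
      by (rule box_pairing_limit[OF u C])
    then show "(\<lambda>n. LINT y|lborel. u y * box_bump l r n (x + y)) \<longlonglongrightarrow> F l r"
      using pairing_translation_invariant[OF box_bump_test_function u C harm dense] by (simp add: F_def)
  qed
  define B where "B = box (- One) (One :: 'a)"
  define c where "c = F (- One) One / measure lborel B"
  have "measure lborel B = (\<Prod>b\<in>(Basis::'a set). 2)"
    by (simp add: B_def measure_lborel_box_eq inner_simps)
  then have "measure lborel B > 0"
    by simp
  have F_eq: "F l r = c * measure lborel (box l r)" for l r
  proof -
    have "F l r * measure lborel B = F (- One) One * measure lborel (box l r)"
      unfolding B_def
      by (rule invariant_pairing_proportional[OF u _ _ C emeasure_lborel_box_finite emeasure_lborel_box_finite F F])
        (auto simp: mem_box)
    then show ?thesis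
      using \<open>measure lborel B > 0\<close> by (simp add: c_def field_simps)
  qed
  have "AE x in lborel. u x - c = 0"
  proof (rule AE_zero_if_box_integrals_zero)
    show "\<bar>u x - c\<bar> \<le> C + \<bar>c\<bar>" for x
      using C[of x] by linarith
    fix l r :: 'a
    note ind = integrable_indicator_box[of l r]
    have "integrable lborel (\<lambda>x. u x * indicator (box l r) x)"
      by (rule Bochner_Integration.integrable_bound[OF integrable_mult_right[OF ind, of C]])
        (use C in \<open>auto simp: indicator_def intro: order_trans[OF C abs_ge_self]\<close>)
    then show "(LINT x|lborel. (u x - c) * indicator (box l r) x) = 0"
      using ind F_eq[of l r] by (simp add: left_diff_distrib F_def)
  qed measurable
  then show ?thesis
    by (intro exI[of _ c]) simp
qed

lemma infdist_translate_subgroup: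
  fixes G :: "'a::real_normed_vector set"
  assumes "add_subgroup G" and "z \<in> G"
  shows "infdist (x + z) G = infdist x G"
proof -
  have le: "infdist (x + z) G \<le> infdist x G" if "z \<in> G" for x z
  proof -
    have "infdist (x + z) G \<le> dist x a" if "a \<in> G" for a
      using infdist_le[OF add_subgroup_closed(4)[OF assms(1) that \<open>z \<in> G\<close>], of "x + z"] by simp
    then show ?thesis
      using \<open>z \<in> G\<close> unfolding infdist_def[of x] by (auto intro: cINF_greatest)
  qed
  show ?thesis
    using le[OF assms(2), of x] le[OF add_subgroup_closed(3)[OF assms], of "x + z"] by simp
qed

lemma (in levy_measure) nondense_imp_nonconstant:
  assumes "closure (group_closure (supp \<nu>)) \<noteq> UNIV"
  obtains u where "continuous_on UNIV u" "\<And>x. \<bar>u x\<bar> \<le> 1" "\<And>c. \<exists>x. u x \<noteq> c"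
    "\<And>\<psi>. test_function \<psi> \<Longrightarrow> (LINT x|lborel. u x * levy_op \<nu> \<psi> x) = 0"
proof -
  define G where "G = group_closure (supp \<nu>)"
  \<comment> \<open>Capping at 1 makes the distance bounded without changing its zeros or its
    periodicity.\<close>
  define u where "u x = min 1 (infdist x G)" for x
  have cont: "continuous_on UNIV u"
    unfolding u_def by (intro continuous_intros)
  show thesis
  proof (rule that[OF cont])
    show bound: "\<bar>u x\<bar> \<le> 1" for x
      using infdist_nonneg[of x G] by (simp add: u_def)
    obtain x where "x \<notin> closure G"
      using assms unfolding G_def by blast
    then have "infdist x G \<noteq> 0"
      using in_closure_iff_infdist_zero[of G x] zero_in_group_closure unfolding G_def by blast
    then have "u x \<noteq> 0"
      by (simp add: u_def min_def)
    moreover have "u 0 = 0"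
      by (simp add: u_def G_def infdist_zero)
    ultimately show "\<exists>x. u x \<noteq> c" for c
      by metis
    show "(LINT x|lborel. u x * levy_op \<nu> \<psi> x) = 0" if "test_function \<psi>" for \<psi>
    proof (rule periodic_imp_pairing_zero[OF borel_measurable_continuous_onI[OF cont] bound _ that])
      fix z x assume "z \<in> supp \<nu>"
      then have "z \<in> G"
        by (simp add: G_def group_closure.base)
      then have "infdist (x + z) G = infdist x G"
        unfolding G_def by (rule infdist_translate_subgroup[OF add_subgroup_group_closure])
      then show "u (x + z) = u x"
        by (simp add: u_def)
    qed
  qed
qed

text \<open>
  The sets of \<open>\<mu>\<close> live on the punctured space; its image \<open>\<nu>\<close> under the inclusion is a measure on
  all Borel sets without mass at \<open>0\<close>.
\<close>

lemma liouville_iff_dense: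
  fixes \<mu> :: "'a::euclidean_space measure"
  assumes radon: "nonneg_radon_punctured \<mu>" and sym: "symmetric_measure \<mu>"
    and fin: "(\<integral>\<^sup>+ z. ennreal (min ((norm z)\<^sup>2) 1) \<partial>\<mu>) < \<infinity>"
  shows "liouville_property \<mu> \<longleftrightarrow> closure (group_closure (supp \<mu>)) = UNIV"
proof -
  have sets: "sets \<mu> = sets (restrict_space borel (- {0}))"
    using radon by (simp add: nonneg_radon_punctured_def)
  then have space: "space \<mu> = - {0}"
    using sets_eq_imp_space_eq[OF sets] by (simp add: space_restrict_space)
  have [measurable]: "(\<lambda>x. x) \<in> \<mu> \<rightarrow>\<^sub>M borel"
    by (subst measurable_cong_sets[OF sets refl]) (simp add: measurable_restrict_space1)
  define \<nu> where "\<nu> = distr \<mu> borel (\<lambda>x. x)"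
  have \<nu>: "emeasure \<nu> A = emeasure \<mu> (A - {0})" if "A \<in> sets borel" for A
    unfolding \<nu>_def using that space by (subst emeasure_distr) (auto simp: Diff_eq Int_commute)
  interpret levy_measure \<nu>
  proof
    show "sets \<nu> = sets borel"
      by (simp add: \<nu>_def)
    show "emeasure \<nu> {0} = 0"
      by (simp add: \<nu>)
    show "distr \<nu> borel uminus = \<nu>"
    proof (rule measure_eqI)
      fix A assume "A \<in> sets (distr \<nu> borel uminus)"
      then have A: "A \<in> sets borel"
        by simp
      have uminus: "uminus -` A \<in> sets borel"
        using measurable_sets[OF borel_measurable_uminus[OF measurable_ident] A] by simp
      have "emeasure (distr \<nu> borel uminus) A = emeasure \<nu> (uminus -` A)"
        using A by (subst emeasure_distr) (simp_all add: \<nu>_def)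
      also have "\<dots> = emeasure \<mu> (uminus -` A - {0})"
        using uminus by (rule \<nu>)
      also have "uminus -` A - {0} = uminus ` (A - {0})"
        by force
      also have "emeasure \<mu> (uminus ` (A - {0})) = emeasure \<mu> (A - {0})"
      proof -
        have "A - {0} \<in> sets \<mu>"
          using A by (auto simp: sets sets_restrict_space Diff_eq)
        then show ?thesis
          using sym by (simp add: symmetric_measure_def)
      qed
      also have "\<dots> = emeasure \<nu> A"
        using A by (rule \<nu>[symmetric])
      finally show "emeasure (distr \<nu> borel uminus) A = emeasure \<nu> A" .
    qed (simp add: \<nu>_def)
    have "integrable \<mu> (\<lambda>z. min ((norm z)\<^sup>2) 1)"
      using fin by (intro integrableI_bounded) (auto simp: abs_of_nonneg)
    then show "integrable \<nu> (\<lambda>z. min ((norm z)\<^sup>2) 1)"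
      unfolding \<nu>_def by (subst integrable_distr_eq) auto
  qed
  have supp: "supp \<nu> = supp \<mu>"
    unfolding supp_def by (simp add: \<nu>)
  have levy: "levy_op \<nu> \<psi> = levy_op \<mu> \<psi>" if "test_function \<psi>" for \<psi>
  proof -
    have [measurable]: "\<psi> \<in> borel_measurable borel"
      using that by measurable
    have "(LINT z:{z. norm z > r}|\<nu>. \<psi> (x + z) - \<psi> x) = (LINT z:{z. norm z > r}|\<mu>. \<psi> (x + z) - \<psi> x)" for r x
      unfolding set_lebesgue_integral_def \<nu>_def by (subst integral_distr) auto
    then show ?thesis
      by (auto simp: levy_op_def[abs_def])
  qed
  \<comment> \<open>Transfers pairings from a Lebesgue measurable \<open>u\<close> and the completed
    measure to a Borel representative, to which the results on \<open>\<nu>\<close> apply.\<close>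
  have pairing: "(LINT x|lebesgue. u x * levy_op \<mu> \<psi> x) = (LINT x|lborel. v x * levy_op \<nu> \<psi> x)"
    if "u \<in> borel_measurable lebesgue" "v \<in> borel_measurable borel"
      and ae: "AE x in lebesgue. u x = v x" and \<psi>: "test_function \<psi>" for u v \<psi>
  proof -
    have borel: "(\<lambda>x. v x * levy_op \<nu> \<psi> x) \<in> borel_measurable lborel"
      using levy_op_measurable[OF \<psi>] that(2) by simp
    have "levy_op \<nu> \<psi> \<in> borel_measurable lebesgue"
      using levy_op_measurable[OF \<psi>] by (intro measurable_completion) simp
    then have "(LINT x|lebesgue. u x * levy_op \<mu> \<psi> x) = (LINT x|lebesgue. v x * levy_op \<nu> \<psi> x)"
      unfolding levy[OF \<psi>, symmetric] using that(1) measurable_completion[OF borel] ae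
      by (intro integral_cong_AE) (auto elim: eventually_mono)
    also have "\<dots> = (LINT x|lborel. v x * levy_op \<nu> \<psi> x)"
      using borel by (rule integral_completion)
    finally show ?thesis .
  qed
  show ?thesis
  proof
    assume dense: "closure (group_closure (supp \<mu>)) = UNIV"
    show "liouville_property \<mu>"
      unfolding liouville_property_def
    proof (intro allI impI)
      fix u :: "'a \<Rightarrow> real"
      assume u: "L_infinity u" and harm: "levy_harmonic \<mu> u"
      obtain C where C: "AE x in lebesgue. \<bar>u x\<bar> \<le> C" and u_meas: "u \<in> borel_measurable lebesgue"
        using u unfolding L_infinity_def by blast
      obtain u' where u': "u' \<in> borel_measurable lborel" "AE x in lborel. u x = u' x"
        using completion_ex_borel_measurable_real[OF u_meas] by blast
      \<comment> \<open>Clamping makes the bound hold everywhere instead of almost everywhere, and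
        alters the Borel representative only on a null set.\<close>
      define v where "v x = max (- \<bar>C\<bar>) (min \<bar>C\<bar> (u' x))" for x
      have v_meas: "v \<in> borel_measurable borel"
        using u'(1) unfolding v_def[abs_def] by simp
      have v: "\<bar>v x\<bar> \<le> \<bar>C\<bar>" for x
        by (auto simp: v_def)
      have ae: "AE x in lebesgue. u x = v x"
        using AE_completion[OF u'(2)] C by eventually_elim (auto simp: v_def)
      have "\<exists>c. AE x in lborel. v x = c"
      proof (rule dense_imp_constant[OF v_meas v])
        show "closure (group_closure (supp \<nu>)) = UNIV"
          using dense supp by simp
        show "(LINT x|lborel. v x * levy_op \<nu> \<psi> x) = 0" if "test_function \<psi>" for \<psi>
          using harm that pairing[OF u_meas v_meas ae that] by (simp add: levy_harmonic_def)
      qed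
      then obtain c where "AE x in lebesgue. v x = c"
        using AE_completion by blast
      with ae have "AE x in lebesgue. u x = c"
        by eventually_elim simp
      then show "\<exists>c. AE x in lebesgue. u x = c" ..
    qed
  next
    assume liouville: "liouville_property \<mu>"
    show "closure (group_closure (supp \<mu>)) = UNIV"
    proof (rule ccontr)
      assume "closure (group_closure (supp \<mu>)) \<noteq> UNIV"
      then have "closure (group_closure (supp \<nu>)) \<noteq> UNIV"
        using supp by simp
      then obtain u where u: "continuous_on UNIV u" "\<And>x. \<bar>u x\<bar> \<le> 1" "\<And>c. \<exists>x. u x \<noteq> c"
        "\<And>\<psi>. test_function \<psi> \<Longrightarrow> (LINT x|lborel. u x * levy_op \<nu> \<psi> x) = 0"
        by (rule nondense_imp_nonconstant) blast
      have borel: "u \<in> borel_measurable borel"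
        using u(1) by (rule borel_measurable_continuous_onI)
      then have meas: "u \<in> borel_measurable lebesgue"
        by (auto intro!: measurable_completion)
      have "L_infinity u"
        unfolding L_infinity_def using meas u(2) by auto
      moreover have "levy_harmonic \<mu> u"
        unfolding levy_harmonic_def using pairing[OF meas borel] u(4) by simp
      ultimately obtain c where "AE x in lebesgue. u x = c"
        using liouville unfolding liouville_property_def by blast
      \<comment> \<open>A closed set of full Lebesgue measure is the whole space, so the continuous
        \<open>u\<close> would be constant everywhere.\<close>
      then have "AE x in lebesgue. x \<in> {x. u x = c}"
        by simp
      moreover have "closed {x. u x = c}"
        using u(1) by (intro closed_Collect_eq) auto
      ultimately have "u x = c" for x
        using mem_closed_if_AE_lebesgue by blast
      then show False
        using u(3) by blast
    qed
  qed
qed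

theorem theorem4p13:
  fixes \<mu> :: "(real ^ 'd) measure"
  assumes "nonneg_radon_punctured \<mu>"
    and "symmetric_measure \<mu>"
    and "(\<integral>\<^sup>+ z. ennreal (min ((norm z)\<^sup>2) 1) \<partial>\<mu>) < \<infinity>"
  shows
    "(liouville_property \<mu> \<longleftrightarrow> closure (group_closure (supp \<mu>)) = UNIV) \<and>
     (liouville_property \<mu> \<longleftrightarrow>
        (\<forall>V \<Lambda>. subspace V \<longrightarrow> dim V \<le> CARD('d) - 1 \<longrightarrow> relative_lattice \<Lambda> \<longrightarrow>
               V \<inter> span \<Lambda> = {0} \<longrightarrow> \<not> supp \<mu> \<subseteq> V + \<Lambda>)) \<and>
     (liouville_property \<mu> \<longleftrightarrow>
        (\<forall>H c. subspace H \<longrightarrow> dim H = CARD('d) - 1 \<longrightarrow>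
               \<not> supp \<mu> \<subseteq> H + range (\<lambda>k::int. real_of_int k *\<^sub>R c)))"
  \<comment> \<open>The dimension of \<open>real ^ 'd\<close> is \<open>CARD('d)\<close>; the
    lattice condition reaches density through the hyperplane condition.\<close>
  using liouville_iff_dense[OF assms] dense_group_closure_iff_hyperplanes[of "supp \<mu>"]
    lattice_avoiding_iff_hyperplanes[of "supp \<mu>"] by simp

end
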